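(* Assume $2\le k\le n-2$, let $F\in\mathrm{Gr}_{n-k}(\mathbb R^n)$, and let $U\subset\mathrm{Gr}_k(\mathbb R^n)$ be any open neighborhood of $\Xi^k_F$. Let $S\subset\mathbb R^n$ be a centrally-symmetric star body around $0\in\mathrm{int}(S)$. Then $S$ is uniquely determined by its section function $A_S(E)=\mathrm{vol}_k(E\cap S)$, $E\in U$. That is, if $S,S'$ are two such star bodies with $A_S(E)=A_{S'}(E)$ for all $E\in U$, then $S=S'$.
   Context: A star body around $0$ with $0\in\mathrm{int}(S)$ is a compact set of the form $S=\{t\theta:\theta\in S^{n-1},\,0\le t\le\rho_S(\theta)\}$ with continuous positive radial function $\rho_S:S^{n-1}\to(0,\infty)$; centrally-symmetric means $S=-S$. $\mathrm{Gr}_k(\mathbb R^n)$ is the grassmannian of $k$-dimensional linear subspaces; for $F\in\mathrm{Gr}_{n-k}(\mathbb R^n)$, $\Xi^k_F=\{E\in\mathrm{Gr}_k(\mathbb R^n):E\cap F\ne\{0\}\}$. *)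

theory Defs
  imports "HOL-Analysis.Analysis"
begin

section \<open>Grassmannians\<close>

definition grassmannian :: "nat \<Rightarrow> 'a::euclidean_space set set" where
  "grassmannian k = {E. subspace E \<and> dim E = k}"

text \<open>For a subspace \<open>E\<close>, the nearest-point map onto \<open>E\<close> is the orthogonal projection; it is
  bounded linear by \<open>orth_proj_apply\<close> below, so that \<open>Blinfun\<close> is applied meaningfully.\<close>

definition orth_proj :: "'a::euclidean_space set \<Rightarrow> 'a \<Rightarrow>\<^sub>L 'a" where
  "orth_proj E = Blinfun (closest_point E)"

text \<open>The usual topology of the Grassmannian, obtained by identifying a subspace with its
  orthogonal projection, i.e. induced by the metric \<open>\<parallel>P\<^sub>E - P\<^sub>F\<parallel>\<close> (operator norm).\<close>

definition grassmannian_topology :: "nat \<Rightarrow> 'a::euclidean_space set topology" where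
  "grassmannian_topology k = pullback_topology (grassmannian k) orth_proj euclidean"

definition Xi :: "nat \<Rightarrow> 'a::euclidean_space set \<Rightarrow> 'a set set" where
  "Xi k F = {E \<in> grassmannian k. E \<inter> F \<noteq> {0}}"

lemma closest_point_in_subspace:
  fixes E :: "'a::euclidean_space set"
  assumes "subspace E"
  shows "closest_point E x \<in> E"
  using closest_point_in_set[OF closed_subspace[OF assms]] subspace_0[OF assms] by blast

lemma closest_point_subspace_orthogonal:
  fixes E :: "'a::euclidean_space set"
  assumes "subspace E" "y \<in> E"
  shows "(x - closest_point E x) \<bullet> y = 0"
proof -
  let ?p = "closest_point E x"
  have cl: "closed E" and cv: "convex E" and p: "?p \<in> E"
    using assms by (auto simp: closest_point_in_subspace closed_subspace subspace_imp_convex)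
  have "?p + y \<in> E" "?p - y \<in> E"
    using assms p by (auto intro: subspace_add subspace_diff)
  from closest_point_dot[OF cv cl this(1), of x] closest_point_dot[OF cv cl this(2), of x]
  show ?thesis by simp
qed

lemma closest_point_subspace_eqI:
  fixes E :: "'a::euclidean_space set"
  assumes "subspace E" "p \<in> E" "\<And>y. y \<in> E \<Longrightarrow> (x - p) \<bullet> y = 0"
  shows "closest_point E x = p"
proof -
  let ?q = "closest_point E x"
  have q: "?q \<in> E"
    using assms by (simp add: closest_point_in_subspace)
  then have d: "?q - p \<in> E"
    using assms by (auto intro: subspace_diff)
  have "(?q - p) \<bullet> (?q - p) = (x - p) \<bullet> (?q - p) - (x - ?q) \<bullet> (?q - p)"
    by (simp add: inner_diff_left)
  also have "\<dots> = 0"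
    using assms(3)[OF d] closest_point_subspace_orthogonal[OF assms(1) d] by simp
  finally show ?thesis by simp
qed

lemma orth_proj_apply:
  fixes E :: "'a::euclidean_space set"
  assumes "subspace E"
  shows "blinfun_apply (orth_proj E) = closest_point E"
proof -
  have in_E: "closest_point E x \<in> E" for x
    using assms by (simp add: closest_point_in_subspace)
  have "linear (closest_point E)"
  proof (rule linearI)
    fix x y
    show "closest_point E (x + y) = closest_point E x + closest_point E y"
      using closest_point_subspace_orthogonal[OF assms, of _ x]
        closest_point_subspace_orthogonal[OF assms, of _ y]
      by (intro closest_point_subspace_eqI assms subspace_add in_E)
        (simp add: inner_diff_left inner_add_left)
  next
    fix r x
    show "closest_point E (r *\<^sub>R x) = r *\<^sub>R closest_point E x"
      using closest_point_subspace_orthogonal[OF assms, of _ x]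
      by (intro closest_point_subspace_eqI assms subspace_scale in_E)
        (simp add: inner_diff_left)
  qed
  then show ?thesis
    unfolding orth_proj_def by (simp add: bounded_linear_Blinfun_apply linear_conv_bounded_linear)
qed

lemma topspace_grassmannian_topology [simp]:
  "topspace (grassmannian_topology k) = grassmannian k"
  by (simp add: grassmannian_topology_def topspace_pullback_topology)

lemma openin_grassmannian_topology:
  "openin (grassmannian_topology k) U \<longleftrightarrow>
     U \<subseteq> grassmannian k \<and>
     (\<forall>E\<in>U. \<exists>e>0. \<forall>E'\<in>grassmannian k. norm (orth_proj E' - orth_proj E) < e \<longrightarrow> E' \<in> U)"
  (is "?L \<longleftrightarrow> ?R")
proof
  assume ?L
  then obtain W where W: "open W" "U = orth_proj -` W \<inter> grassmannian k"
    by (auto simp: grassmannian_topology_def openin_pullback_topology)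
  show ?R
    using W unfolding open_dist by (fastforce simp: dist_norm)
next
  assume R: ?R
  then obtain e where e: "\<And>E. E \<in> U \<Longrightarrow> e E > 0"
    "\<And>E E'. E \<in> U \<Longrightarrow> E' \<in> grassmannian k \<Longrightarrow> norm (orth_proj E' - orth_proj E) < e E \<Longrightarrow> E' \<in> U"
    by metis
  define W where "W = (\<Union>E\<in>U. ball (orth_proj E) (e E))"
  have "U = orth_proj -` W \<inter> grassmannian k"
    using R e by (auto simp: W_def dist_norm norm_minus_commute)
      (metis cancel_comm_monoid_add_class.diff_cancel norm_zero)
  moreover have "open W"
    by (auto simp: W_def)
  ultimately show ?L
    by (auto simp: grassmannian_topology_def openin_pullback_topology)
qed


section \<open>Volume on a subspace\<close>

definition orthonormal_basis :: "'a::euclidean_space set \<Rightarrow> 'a set \<Rightarrow> bool" where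
  "orthonormal_basis E B \<longleftrightarrow> pairwise orthogonal B \<and> (\<forall>b\<in>B. norm b = 1) \<and> span B = E"

lemma orthonormal_basis_exists:
  "subspace E \<Longrightarrow> \<exists>B. orthonormal_basis E B"
  unfolding orthonormal_basis_def by (metis orthonormal_basis_subspace)

text \<open>Lebesgue measure of a subspace \<open>E\<close>, defined like \<open>lborel\<close> but with an orthonormal basis
  of \<open>E\<close> in place of \<open>Basis\<close>. By rotation invariance of Lebesgue measure the choice of the
  orthonormal basis is immaterial.\<close>

definition subspace_lborel :: "'a::euclidean_space set \<Rightarrow> 'a measure" where
  "subspace_lborel E =
     (let B = (SOME B. orthonormal_basis E B)
      in distr (\<Pi>\<^sub>M b\<in>B. lborel) borel (\<lambda>c. \<Sum>b\<in>B. c b *\<^sub>R b))"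

text \<open>For \<open>E\<close> in \<open>grassmannian k\<close> this is the \<open>k\<close>-dimensional volume of \<open>E \<inter> S\<close>.\<close>

definition section_function :: "'a::euclidean_space set \<Rightarrow> 'a set \<Rightarrow> real" where
  "section_function S E = measure (subspace_lborel E) (E \<inter> S)"


section \<open>Star bodies\<close>

definition star_body :: "'a::euclidean_space set \<Rightarrow> bool" where
  "star_body S \<longleftrightarrow> compact S \<and>
     (\<exists>\<rho>. continuous_on (sphere 0 1) \<rho> \<and> (\<forall>\<theta>\<in>sphere 0 1. 0 < \<rho> \<theta>) \<and>
          S = {t *\<^sub>R \<theta> | t \<theta>. \<theta> \<in> sphere 0 1 \<and> 0 \<le> t \<and> t \<le> (\<rho> \<theta> :: real)})"

definition centrally_symmetric :: "'a::euclidean_space set \<Rightarrow> bool" where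
  "centrally_symmetric S \<longleftrightarrow> S = uminus ` S"

end

theory Submission
  imports Defs "HOL-Probability.Probability" "HOL-Real_Asymp.Real_Asymp"
begin

text \<open>
  Given a point \<open>x\<close>, choose a subspace \<open>H\<close> of
  dimension \<open>k + 1\<close> that contains \<open>x\<close> and a plane of \<open>F\<close> (recall \<open>dim F \<ge> 2\<close>): every
  hyperplane \<open>E\<close> of \<open>H\<close> meets that plane, so \<open>E \<in> Xi k F\<close>. Thus it suffices to invert the
  spherical Radon (Funk) transform in \<open>H\<close>: for \<open>\<psi> = indicator S - indicator S'\<close>, if
  \<open>\<integral>\<^sub>E \<psi> = 0\<close> for all hyperplanes \<open>E\<close> of \<open>H\<close>, then \<open>S \<inter> H = S' \<inter> H\<close>.

  Let \<open>\<xi>\<close> be a standard Gaussian vector in \<open>H\<close>. On the one hand,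
  \<open>n \<integral>\<^sub>H \<psi> y * exp (- (n * (\<xi> \<bullet> y))\<^sup>2 / 2) dy\<close> tends to a multiple of the integral of
  \<open>\<psi>\<close> over the hyperplane orthogonal to \<open>\<xi>\<close>, i.e. to \<open>0\<close>. On the other hand, the average of
  \<open>n * cos (\<xi> \<bullet> x) * exp (- (n * (\<xi> \<bullet> y))\<^sup>2 / 2)\<close> over \<open>\<xi>\<close> is an explicit kernel that tends
  to \<open>exp (- (norm x)\<^sup>2 * q y / 2) / norm y\<close>, where \<open>q y\<close> is the squared sine of the angle
  between \<open>x\<close> and \<open>y\<close>. Hence \<open>\<psi> y / norm y\<close> is orthogonal to all these kernels, and
  scaling \<open>x\<close> to infinity concentrates them on the line through \<open>x\<close>. Near the line through a
  point of \<open>S - S'\<close>, the function \<open>\<psi>\<close> is nonnegative, because both bodies are star-shaped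
  and symmetric, and it is not almost everywhere zero: a contradiction.
\<close>

section \<open>Lebesgue measure on a subspace\<close>

definition lincomb :: "'a::euclidean_space set \<Rightarrow> ('a \<Rightarrow> real) \<Rightarrow> 'a" where
  "lincomb B c = (\<Sum>b\<in>B. c b *\<^sub>R b)"

lemma onb_finite: "orthonormal_basis E B \<Longrightarrow> finite B"
  and onb_independent: "orthonormal_basis E B \<Longrightarrow> independent B"
proof -
  assume "orthonormal_basis E B"
  then have "pairwise orthogonal B" "0 \<notin> B"
    by (auto simp: orthonormal_basis_def)
  then show "independent B"
    by (rule pairwise_orthogonal_independent)
  then show "finite B"
    using independent_imp_finite by blast
qed

lemma onb_card: "orthonormal_basis E B \<Longrightarrow> card B = dim E"
  by (metis dim_span_eq_card_independent onb_independent orthonormal_basis_def)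

lemma onb_span: "orthonormal_basis E B \<Longrightarrow> span B = E"
  by (simp add: orthonormal_basis_def)

lemma onb_in: "orthonormal_basis E B \<Longrightarrow> b \<in> B \<Longrightarrow> b \<in> E"
  using onb_span span_base by blast

lemma onb_inner:
  "orthonormal_basis E B \<Longrightarrow> b \<in> B \<Longrightarrow> b' \<in> B \<Longrightarrow> b \<bullet> b' = (if b = b' then 1 else 0)"
  unfolding orthonormal_basis_def pairwise_def orthogonal_def by (metis norm_eq_1)

lemma lincomb_in_span: "lincomb B c \<in> span B"
  unfolding lincomb_def by (intro span_sum span_scale span_base)

lemma inner_lincomb: "x \<bullet> lincomb B c = (\<Sum>b\<in>B. c b * (x \<bullet> b))"
  unfolding lincomb_def by (simp add: inner_sum_right)

lemma lincomb_add: "lincomb B (\<lambda>b. c b + d b) = lincomb B c + lincomb B d"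
  unfolding lincomb_def by (simp add: sum.distrib scaleR_add_left)

lemma lincomb_scale: "lincomb B (\<lambda>b. r * c b) = r *\<^sub>R lincomb B c"
  unfolding lincomb_def by (simp add: scaleR_sum_right)

lemma lincomb_cong: "(\<And>b. b \<in> B \<Longrightarrow> c b = d b) \<Longrightarrow> lincomb B c = lincomb B d"
  unfolding lincomb_def by (intro sum.cong) auto

lemma onb_coord:
  assumes "orthonormal_basis E B" "b \<in> B"
  shows "lincomb B c \<bullet> b = c b"
proof -
  have "lincomb B c \<bullet> b = (\<Sum>b'\<in>B. c b' * (b \<bullet> b'))"
    by (simp add: inner_lincomb inner_commute[of _ b])
  also have "\<dots> = (\<Sum>b'\<in>B. if b = b' then c b' else 0)"
    using assms by (intro sum.cong) (auto simp: onb_inner)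
  finally show ?thesis
    using assms(2) onb_finite[OF assms(1)] by simp
qed

lemma onb_expand:
  assumes "orthonormal_basis E B" "x \<in> E"
  shows "lincomb B (\<lambda>b. x \<bullet> b) = x"
  using assms onb_finite orthonormal_basis_expand[of B x]
  unfolding lincomb_def orthonormal_basis_def by auto

lemma onb_inner_expand:
  assumes "orthonormal_basis E B" "y \<in> E"
  shows "x \<bullet> y = (\<Sum>b\<in>B. (x \<bullet> b) * (y \<bullet> b))"
  by (subst onb_expand[OF assms, symmetric]) (simp add: inner_lincomb mult.commute)

lemma onb_norm_lincomb:
  assumes "orthonormal_basis E B"
  shows "(norm (lincomb B c))\<^sup>2 = (\<Sum>b\<in>B. (c b)\<^sup>2)"
proof -
  have "(norm (lincomb B c))\<^sup>2 = (\<Sum>b\<in>B. c b * (lincomb B c \<bullet> b))"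
    by (simp add: power2_norm_eq_inner inner_lincomb)
  then show ?thesis
    using onb_coord[OF assms] by (simp add: power2_eq_square)
qed

lemma onb_subspace: "orthonormal_basis E B \<Longrightarrow> subspace E"
  by (metis onb_span subspace_span)

lemma onb_closest_point:
  assumes "orthonormal_basis E B"
  shows "closest_point E x = lincomb B (\<lambda>b. x \<bullet> b)"
proof (rule closest_point_subspace_eqI)
  show "subspace E" "lincomb B (\<lambda>b. x \<bullet> b) \<in> E"
    using assms onb_subspace lincomb_in_span onb_span by blast+
  fix y assume "y \<in> E"
  then show "(x - lincomb B (\<lambda>b. x \<bullet> b)) \<bullet> y = 0"
    by (simp add: onb_inner_expand[OF assms] inner_diff_left onb_coord[OF assms])
qed

text \<open>The factor \<open>M\<close> is left open so that one construction yields both Lebesgue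
  measure on \<open>span B\<close> (\<open>M = lborel\<close>) and the standard Gaussian measure
  there (\<open>M = std_normal_distribution\<close>).\<close>

definition basis_measure :: "'a::euclidean_space set \<Rightarrow> real measure \<Rightarrow> 'a measure" where
  "basis_measure B M = distr (\<Pi>\<^sub>M b\<in>B. M) borel (lincomb B)"

lemma sets_basis_measure [measurable_cong, simp]: "sets (basis_measure B M) = sets borel"
  by (simp add: basis_measure_def)

lemma space_basis_measure [simp]: "space (basis_measure B M) = UNIV"
  by (simp add: basis_measure_def)

lemma borel_measurable_lincomb [measurable]:
  assumes "sets M = sets borel"
  shows "lincomb B \<in> borel_measurable (\<Pi>\<^sub>M b\<in>B. M)"
proof -
  have [measurable]: "(\<lambda>c. c b) \<in> borel_measurable (\<Pi>\<^sub>M b\<in>B. M)" if "b \<in> B" for b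
    using measurable_component_singleton[OF that, of "\<lambda>_. M"] assms measurable_cong_sets by blast
  show ?thesis
    unfolding lincomb_def by measurable
qed

lemma AE_basis_measure_span:
  assumes "sets M = sets borel"
  shows "AE x in basis_measure B M. x \<in> span B"
  unfolding basis_measure_def using assms
  by (subst AE_distr_iff) (auto simp: lincomb_in_span closed_subspace borel_closed)

lemma nn_integral_basis_measure:
  assumes "sets M = sets borel" and [measurable]: "f \<in> borel_measurable borel"
  shows "(\<integral>\<^sup>+x. f x \<partial>basis_measure B M) = (\<integral>\<^sup>+c. f (lincomb B c) \<partial>(\<Pi>\<^sub>M b\<in>B. M))"
  unfolding basis_measure_def using assms(1) by (subst nn_integral_distr) auto

section \<open>Invariance of the measure and independence of the basis\<close>

interpretation lborel_product: product_sigma_finite "\<lambda>_. lborel :: real measure"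
  by standard

text \<open>Each coordinate map preserves \<open>lborel\<close>, and boxes determine the product
  measure. Allowing \<open>\<bar>s\<bar> = 1\<close> treats translations and point reflections
  together; the uniqueness proof for the measure uses both.\<close>

lemma distr_PiM_lborel_affine:
  fixes a :: "'i \<Rightarrow> real"
  assumes "finite I" and s: "\<bar>s\<bar> = 1"
  shows "distr (\<Pi>\<^sub>M i\<in>I. lborel) (\<Pi>\<^sub>M i\<in>I. lborel) (\<lambda>c. \<lambda>i\<in>I. a i + s * c i) = (\<Pi>\<^sub>M i\<in>I. lborel)"
    (is "distr ?P _ ?T = _")
proof (rule lborel_product.PiM_eqI)
  have T [measurable]: "?T \<in> measurable ?P ?P"
    by measurable
  have s0: "s \<noteq> 0" using s by auto
  fix A :: "'i \<Rightarrow> real set" assume A: "\<And>i. i \<in> I \<Longrightarrow> A i \<in> sets lborel"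
  have pre: "?T -` Pi\<^sub>E I A \<inter> space ?P = Pi\<^sub>E I (\<lambda>i. {t. a i + s * t \<in> A i})"
    by (auto simp: space_PiM PiE_iff extensional_def)
  have *: "{t. a i + s * t \<in> A i} \<in> sets lborel \<and> emeasure lborel {t. a i + s * t \<in> A i} = emeasure lborel (A i)"
    if "i \<in> I" for i
  proof -
    have [measurable]: "A i \<in> sets borel" using A[OF that] by simp
    have "lborel = distr lborel borel (\<lambda>x. a i + s * x)"
      using lborel_real_affine[OF s0, of "a i"] s by (simp add: density_1 flip: one_ennreal_def)
    then have "emeasure lborel (A i) = emeasure (distr lborel borel (\<lambda>x. a i + s * x)) (A i)"
      by simp
    also have "\<dots> = emeasure lborel {t. a i + s * t \<in> A i}"
      by (subst emeasure_distr) (auto simp: vimage_def)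
    finally show ?thesis by (simp, measurable)
  qed
  have "emeasure (distr ?P ?P ?T) (Pi\<^sub>E I A) = emeasure ?P (Pi\<^sub>E I (\<lambda>i. {t. a i + s * t \<in> A i}))"
    using A assms by (subst emeasure_distr) (auto simp: pre intro!: sets_PiM_I_finite)
  also have "\<dots> = (\<Prod>i\<in>I. emeasure lborel {t. a i + s * t \<in> A i})"
    using * assms by (intro lborel_product.emeasure_PiM) auto
  also have "\<dots> = (\<Prod>i\<in>I. emeasure lborel (A i))"
    using * by (intro prod.cong) auto
  finally show "emeasure (distr ?P ?P ?T) (Pi\<^sub>E I A) = (\<Prod>i\<in>I. emeasure lborel (A i))" .
qed (use assms in auto)

lemma nn_integral_basis_measure_affine:
  fixes E :: "'a::euclidean_space set"
  assumes B: "orthonormal_basis E B" and "v \<in> E" and s: "\<bar>s\<bar> = 1"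
    and [measurable]: "f \<in> borel_measurable borel"
  shows "(\<integral>\<^sup>+x. f (v + s *\<^sub>R x) \<partial>basis_measure B lborel) = (\<integral>\<^sup>+x. f x \<partial>basis_measure B lborel)"
proof -
  let ?P = "\<Pi>\<^sub>M b\<in>B. (lborel :: real measure)"
  have fin: "finite B" using B by (rule onb_finite)
  \<comment> \<open>Points of the product space are extensional functions, hence the restriction of
    the new coordinates to \<open>B\<close>.\<close>
  have eq: "v + s *\<^sub>R lincomb B c = lincomb B (\<lambda>b\<in>B. v \<bullet> b + s * c b)" for c
  proof -
    have "lincomb B (\<lambda>b\<in>B. v \<bullet> b + s * c b) = lincomb B (\<lambda>b. v \<bullet> b + s * c b)"
      by (intro lincomb_cong) auto
    then show ?thesis
      using onb_expand[OF B \<open>v \<in> E\<close>] by (simp add: lincomb_add lincomb_scale)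
  qed
  have "(\<integral>\<^sup>+x. f x \<partial>basis_measure B lborel)
      = (\<integral>\<^sup>+c. f (lincomb B c) \<partial>distr ?P ?P (\<lambda>c. \<lambda>b\<in>B. v \<bullet> b + s * c b))"
    by (subst distr_PiM_lborel_affine[OF fin s]) (simp add: nn_integral_basis_measure)
  also have "\<dots> = (\<integral>\<^sup>+c. f (v + s *\<^sub>R lincomb B c) \<partial>?P)"
    by (subst nn_integral_distr) (auto simp: eq)
  finally show ?thesis
    by (simp add: nn_integral_basis_measure)
qed

text \<open>The sets \<open>A j\<close> are cylinders in the ambient space, but in the coordinates
  of \<open>B\<close> they are cubes of side \<open>2 * j\<close>, so their measure is
  finite.\<close>

lemma sigma_finite_basis_measure:
  assumes "orthonormal_basis E B"
  shows "sigma_finite_measure (basis_measure B lborel)"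
proof
  let ?P = "\<Pi>\<^sub>M b\<in>B. (lborel :: real measure)"
  define A where "A j = {x. \<forall>b\<in>B. \<bar>x \<bullet> b\<bar> \<le> real j}" for j :: nat
  have fin: "finite B" using assms by (rule onb_finite)
  have clA: "closed (A j)" for j
  proof -
    have "A j = (\<Inter>b\<in>B. {x. \<bar>x \<bullet> b\<bar> \<le> real j})" by (auto simp: A_def)
    then show ?thesis by (auto intro!: closed_INT closed_Collect_le continuous_intros)
  qed
  have "emeasure (basis_measure B lborel) (A j) \<noteq> \<infinity>" for j
  proof -
    have "lincomb B -` A j \<inter> space ?P = Pi\<^sub>E B (\<lambda>_. {- real j..real j})"
      by (auto simp: A_def onb_coord[OF assms] space_PiM PiE_iff abs_le_iff) 
        (metis abs_le_iff neg_le_iff_le minus_minus)+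
    then have "emeasure (basis_measure B lborel) (A j) = (\<Prod>b\<in>B. emeasure lborel {- real j..real j})"
      unfolding basis_measure_def using clA[of j] fin lborel_product.emeasure_PiM[OF fin, of "\<lambda>_. {- real j..real j}"]
      by (subst emeasure_distr) (auto simp: borel_closed)
    then show ?thesis by (simp add: ennreal_power[symmetric] ennreal_mult_eq_top_iff power_eq_top_ennreal)
  qed
  moreover have "(\<Union>j. A j) = UNIV"
  proof -
    have "\<exists>j. x \<in> A j" for x
    proof -
      obtain j where "norm x \<le> real j" using real_arch_simple by blast
      moreover have "\<bar>x \<bullet> b\<bar> \<le> norm x" if "b \<in> B" for b
        using Cauchy_Schwarz_ineq2[of x b] that assms by (auto simp: orthonormal_basis_def)
      ultimately have "x \<in> A j" unfolding A_def by (blast intro: order_trans)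
      then show ?thesis ..
    qed
    then show ?thesis by auto
  qed
  ultimately show "\<exists>A. countable A \<and> A \<subseteq> sets (basis_measure B lborel) \<and> \<Union> A = space (basis_measure B lborel) \<and>
      (\<forall>a\<in>A. emeasure (basis_measure B lborel) a \<noteq> \<infinity>)"
    using clA by (intro exI[of _ "range A"]) (auto intro: borel_closed)
qed

lemma nn_integral_gaussian:
  "(\<integral>\<^sup>+t. ennreal (exp (- (t\<^sup>2 / 2))) \<partial>lborel) = ennreal (sqrt (2 * pi))"
proof -
  have "(\<integral>\<^sup>+t. ennreal (exp (- (t\<^sup>2 / 2))) \<partial>lborel)
      = (\<integral>\<^sup>+t. ennreal (sqrt (2 * pi)) * ennreal (std_normal_density t) \<partial>lborel)"
    by (intro nn_integral_cong) (simp add: std_normal_density_def ennreal_mult[symmetric])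
  also have "\<dots> = ennreal (sqrt (2 * pi)) * (\<integral>\<^sup>+t. ennreal (std_normal_density t) \<partial>lborel)"
    by (intro nn_integral_cmult) auto
  also have "(\<integral>\<^sup>+t. ennreal (std_normal_density t) \<partial>lborel) = 1"
    by (subst nn_integral_eq_integral) auto
  finally show ?thesis by simp
qed

lemma nn_integral_basis_measure_gaussian:
  assumes B: "orthonormal_basis E B"
  shows "(\<integral>\<^sup>+x. ennreal (exp (- ((norm x)\<^sup>2 / 2))) \<partial>basis_measure B lborel) = ennreal (sqrt (2 * pi)) ^ dim E"
proof -
  have "(\<integral>\<^sup>+x. ennreal (exp (- ((norm x)\<^sup>2 / 2))) \<partial>basis_measure B lborel)
    = (\<integral>\<^sup>+c. (\<Prod>b\<in>B. ennreal (exp (- ((c b)\<^sup>2 / 2)))) \<partial>(\<Pi>\<^sub>M b\<in>B. lborel))"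
    by (subst nn_integral_basis_measure)
      (auto simp: onb_norm_lincomb[OF B] prod_ennreal exp_sum[OF onb_finite[OF B], symmetric]
        sum_negf sum_divide_distrib)
  also have "\<dots> = (\<Prod>b\<in>B. \<integral>\<^sup>+t. ennreal (exp (- (t\<^sup>2 / 2))) \<partial>lborel)"
    by (rule lborel_product.product_nn_integral_prod) (auto intro: onb_finite[OF B])
  finally show ?thesis
    by (simp add: nn_integral_gaussian onb_card[OF B])
qed

text \<open>Uniqueness of Haar measure on \<open>E\<close>: for two translation and reflection invariant measures
  \<open>\<mu>\<close>, \<open>\<nu>\<close>, evaluating \<open>\<integral>\<integral> f x * g (y - x)\<close> in both orders gives
  \<open>\<mu> f * \<nu> g = \<mu> g * \<nu> f\<close>; the Gaussian \<open>g\<close> has the same integral for both.\<close>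

lemma basis_measure_unique:
  fixes E :: "'a::euclidean_space set"
  assumes B: "orthonormal_basis E B" and B': "orthonormal_basis E B'"
  shows "basis_measure B lborel = basis_measure B' lborel"
proof (rule measure_eqI)
  let ?\<mu> = "basis_measure B lborel" and ?\<nu> = "basis_measure B' lborel"
  interpret \<mu>: sigma_finite_measure ?\<mu> using B by (rule sigma_finite_basis_measure)
  interpret \<nu>: sigma_finite_measure ?\<nu> using B' by (rule sigma_finite_basis_measure)
  interpret P: pair_sigma_finite ?\<mu> ?\<nu> ..
  show "sets ?\<mu> = sets ?\<nu>" by simp
  fix A assume "A \<in> sets ?\<mu>"
  then have [measurable]: "A \<in> sets borel" by simp
  define g :: "'a \<Rightarrow> ennreal" where "g x = ennreal (exp (- ((norm x)\<^sup>2 / 2)))" for x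
  define f :: "'a \<Rightarrow> ennreal" where "f = indicator A"
  have [measurable]: "g \<in> borel_measurable borel" "f \<in> borel_measurable borel"
    unfolding g_def f_def by measurable
  have aemu: "AE x in ?\<mu>. x \<in> E" and aenu: "AE x in ?\<nu>. x \<in> E"
    using AE_basis_measure_span[of lborel B] AE_basis_measure_span[of lborel B'] onb_span[OF B] onb_span[OF B']
    by auto
  have gnu: "(\<integral>\<^sup>+y. g y \<partial>?\<nu>) = (\<integral>\<^sup>+y. g y \<partial>?\<mu>)"
    unfolding g_def by (simp add: nn_integral_basis_measure_gaussian[OF B] nn_integral_basis_measure_gaussian[OF B'])
  have "(\<integral>\<^sup>+x. \<integral>\<^sup>+y. f x * g (y - x) \<partial>?\<nu> \<partial>?\<mu>) = (\<integral>\<^sup>+x. f x * (\<integral>\<^sup>+y. g y \<partial>?\<nu>) \<partial>?\<mu>)"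
    using aemu
  proof (intro nn_integral_cong_AE, elim AE_mp, intro AE_I2 impI)
    \<comment> \<open>The measure is invariant only under translations along \<open>E\<close>. This
      is enough since it is concentrated on \<open>E\<close>.\<close>
    fix x assume "x \<in> E"
    then have "- x \<in> E" using B onb_subspace subspace_neg by blast
    from nn_integral_basis_measure_affine[OF B' this, of 1 g]
    show "(\<integral>\<^sup>+y. f x * g (y - x) \<partial>?\<nu>) = f x * (\<integral>\<^sup>+y. g y \<partial>?\<nu>)"
      by (simp add: nn_integral_cmult)
  qed
  also have "\<dots> = emeasure ?\<mu> A * (\<integral>\<^sup>+y. g y \<partial>?\<nu>)"
    by (simp add: nn_integral_multc f_def)
  finally have 1: "(\<integral>\<^sup>+x. \<integral>\<^sup>+y. f x * g (y - x) \<partial>?\<nu> \<partial>?\<mu>) = emeasure ?\<mu> A * (\<integral>\<^sup>+y. g y \<partial>?\<mu>)"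
    by (simp add: gnu)
  have "(\<integral>\<^sup>+x. \<integral>\<^sup>+y. f x * g (y - x) \<partial>?\<nu> \<partial>?\<mu>) = (\<integral>\<^sup>+y. \<integral>\<^sup>+x. f x * g (y - x) \<partial>?\<mu> \<partial>?\<nu>)"
    by (rule P.Fubini'[symmetric]) measurable
  also have "\<dots> = (\<integral>\<^sup>+y. \<integral>\<^sup>+x. f (y - x) * g x \<partial>?\<mu> \<partial>?\<nu>)"
    using aenu
  proof (intro nn_integral_cong_AE, elim AE_mp, intro AE_I2 impI)
    \<comment> \<open>Substitution of \<open>y - x\<close> for \<open>x\<close>: the affine
      invariance with \<open>v = y\<close> and \<open>s = -1\<close>.\<close>
    fix y assume "y \<in> E"
    from nn_integral_basis_measure_affine[OF B this, of "-1" "\<lambda>x. f x * g (y - x)"]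
    show "(\<integral>\<^sup>+x. f x * g (y - x) \<partial>?\<mu>) = (\<integral>\<^sup>+x. f (y - x) * g x \<partial>?\<mu>)"
      by simp
  qed
  also have "\<dots> = (\<integral>\<^sup>+x. \<integral>\<^sup>+y. f (y - x) * g x \<partial>?\<nu> \<partial>?\<mu>)"
    by (rule P.Fubini') measurable
  also have "\<dots> = (\<integral>\<^sup>+x. (\<integral>\<^sup>+y. f y \<partial>?\<nu>) * g x \<partial>?\<mu>)"
    using aemu
  proof (intro nn_integral_cong_AE, elim AE_mp, intro AE_I2 impI)
    fix x assume "x \<in> E"
    then have "- x \<in> E" using B onb_subspace subspace_neg by blast
    from nn_integral_basis_measure_affine[OF B' this, of 1 f]
    show "(\<integral>\<^sup>+y. f (y - x) * g x \<partial>?\<nu>) = (\<integral>\<^sup>+y. f y \<partial>?\<nu>) * g x"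
      by (simp add: nn_integral_multc)
  qed
  also have "\<dots> = emeasure ?\<nu> A * (\<integral>\<^sup>+y. g y \<partial>?\<mu>)"
    by (simp add: nn_integral_cmult f_def)
  finally have "emeasure ?\<mu> A * (\<integral>\<^sup>+y. g y \<partial>?\<mu>) = emeasure ?\<nu> A * (\<integral>\<^sup>+y. g y \<partial>?\<mu>)"
    using 1 by simp
  \<comment> \<open>The Gaussian integral is finite and nonzero, so it can be cancelled.\<close>
  moreover have "(\<integral>\<^sup>+y. g y \<partial>?\<mu>) = ennreal (sqrt (2 * pi) ^ dim E)"
    unfolding g_def by (simp add: nn_integral_basis_measure_gaussian[OF B] ennreal_power)
  ultimately show "emeasure ?\<mu> A = emeasure ?\<nu> A"
    by (simp add: mult.commute[of "emeasure _ _"] ennreal_mult_cancel_left)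
qed

lemma subspace_lborel_eq:
  assumes "orthonormal_basis E B"
  shows "subspace_lborel E = basis_measure B lborel"
proof -
  have "orthonormal_basis E (SOME B. orthonormal_basis E B)"
    using assms by (rule someI)
  then show ?thesis
    unfolding subspace_lborel_def Let_def
    by (subst basis_measure_unique[OF assms]) (auto simp: basis_measure_def lincomb_def[abs_def])
qed

text \<open>\<open>C\<close> is an orthonormal basis of the orthogonal complement of
  \<open>E\<close> in \<open>G\<close>; a dimension count shows that \<open>B \<union> C\<close>
  spans \<open>G\<close>.\<close>

lemma onb_extend:
  fixes E G :: "'a::euclidean_space set"
  assumes B: "orthonormal_basis E B" and G: "subspace G" "E \<subseteq> G"
  obtains C where "B \<inter> C = {}" "orthonormal_basis G (B \<union> C)"
proof -
  define E' where "E' = {y \<in> G. \<forall>x\<in>E. orthogonal x y}"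
  have E: "subspace E" using B by (rule onb_subspace)
  have "subspace E'"
    using G(1) unfolding E'_def
    by (auto simp: subspace_def orthogonal_def inner_add_right)
  then obtain C where C: "orthonormal_basis E' C"
    using orthonormal_basis_exists by blast
  have orth: "b \<bullet> c = 0" if "b \<in> B" "c \<in> C" for b c
    using onb_in[OF B that(1)] onb_in[OF C that(2)] by (auto simp: E'_def orthogonal_def)
  then have orth': "c \<bullet> b = 0" if "b \<in> B" "c \<in> C" for b c
    using that by (simp add: inner_commute)
  have disj: "B \<inter> C = {}"
  proof (rule ccontr)
    assume "B \<inter> C \<noteq> {}"
    then obtain b where "b \<in> B" "b \<in> C" by blast
    then show False using orth[of b b] B by (auto simp: orthonormal_basis_def)
  qed
  have pw: "pairwise orthogonal (B \<union> C)"
    using B C orth orth'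
    unfolding pairwise_def orthonormal_basis_def orthogonal_def by blast
  have n1: "\<forall>b\<in>B \<union> C. norm b = 1"
    using B C by (auto simp: orthonormal_basis_def)
  have ind: "independent (B \<union> C)"
    using pw n1 by (metis norm_zero pairwise_orthogonal_independent zero_neq_one)
  have sub: "B \<union> C \<subseteq> G"
    using onb_in[OF B] onb_in[OF C] G(2) by (auto simp: E'_def)
  have "card (B \<union> C) = dim G"
    using dim_subspace_orthogonal_to_vectors[OF E G] onb_card[OF B] onb_card[OF C] disj
      onb_finite[OF B] onb_finite[OF C]
    by (simp add: card_Un_disjoint E'_def)
  then have "G \<subseteq> span (B \<union> C)"
    using sub ind by (intro card_ge_dim_independent) auto
  moreover have "span (B \<union> C) \<subseteq> G"
    using sub G(1) by (rule span_minimal)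
  ultimately have "orthonormal_basis G (B \<union> C)"
    using pw n1 by (auto simp: orthonormal_basis_def)
  with disj that show thesis by blast
qed

section \<open>Transfer from full-dimensional Lebesgue measure\<close>

lemma lborel_eq_basis_measure:
  assumes "orthonormal_basis UNIV B"
  shows "lborel = basis_measure B lborel"
proof -
  have "orthonormal_basis UNIV (Basis :: 'a set)"
    by (auto simp: orthonormal_basis_def pairwise_def orthogonal_def inner_Basis)
  from basis_measure_unique[OF this assms] show ?thesis
    by (subst (1) lborel_eq) (simp add: basis_measure_def lincomb_def[abs_def])
qed

text \<open>When \<open>C\<close> is an orthonormal basis of the complement of \<open>E\<close>,
  this is \<open>A \<inter> E\<close> thickened by a unit cube. It serves to reduce finiteness,
  negligibility and positivity on \<open>E\<close> to the same questions for
  \<open>lborel\<close>.\<close>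

definition slab :: "'a::euclidean_space set \<Rightarrow> 'a set \<Rightarrow> 'a set \<Rightarrow> 'a set" where
  "slab E C A = {x. closest_point E x \<in> A \<and> (\<forall>c\<in>C. 0 \<le> x \<bullet> c \<and> x \<bullet> c \<le> 1)}"

lemma continuous_on_closest_point_subspace:
  fixes E :: "'a::euclidean_space set"
  shows
  "subspace E \<Longrightarrow> continuous_on A (closest_point E)"
  using linear_continuous_on[OF blinfun.bounded_linear_right, of A "orth_proj E"]
  by (simp add: orth_proj_apply)

lemma borel_measurable_closest_point:
  fixes E :: "'a::euclidean_space set"
  shows "subspace E \<Longrightarrow> closest_point E \<in> borel_measurable borel"
  by (intro borel_measurable_continuous_onI) (rule continuous_on_closest_point_subspace)

lemma slab_borel:
  assumes "subspace E" "finite C" and [measurable]: "A \<in> sets borel"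
  shows "slab E C A \<in> sets borel"
proof -
  note [measurable] = borel_measurable_closest_point[OF assms(1)]
  have "slab E C A = closest_point E -` A \<inter> (\<Inter>c\<in>C. {x. 0 \<le> x \<bullet> c} \<inter> {x. x \<bullet> c \<le> 1})"
    by (auto simp: slab_def)
  moreover have "closed (\<Inter>c\<in>C. {x. 0 \<le> x \<bullet> c} \<inter> {x. x \<bullet> c \<le> 1})"
    by (intro closed_INT ballI closed_Int closed_Collect_le continuous_intros)
  ultimately show ?thesis
    using measurable_sets[OF borel_measurable_closest_point[OF assms(1)] assms(3)]
    by (auto intro: borel_closed)
qed

text \<open>In the coordinates of \<open>B \<union> C\<close> the slab is a product of the
  coordinate set of \<open>A\<close> with the unit cube over \<open>C\<close>, which has measure 1;
  Tonelli gives the equality.\<close>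

lemma emeasure_subspace_lborel_slab:
  fixes E :: "'a::euclidean_space set"
  assumes B: "orthonormal_basis E B" and BC: "orthonormal_basis UNIV (B \<union> C)" "B \<inter> C = {}"
    and [measurable]: "A \<in> sets borel"
  shows "emeasure (subspace_lborel E) A = emeasure lborel (slab E C A)"
proof -
  have fin: "finite B" "finite C" using onb_finite[OF BC(1)] by auto
  have [measurable]: "slab E C A \<in> sets borel"
    using onb_subspace[OF B] fin by (intro slab_borel) auto
  have Cc: "(\<Pi>\<^sub>E c\<in>C. {0..1::real}) \<in> sets (\<Pi>\<^sub>M c\<in>C. lborel)"
    using fin by (intro sets_PiM_I_finite) auto
  have *: "indicator (slab E C A) (lincomb (B \<union> C) (merge B C (x, y)))
      = (indicator A (lincomb B x) * indicator (\<Pi>\<^sub>E c\<in>C. {0..1::real}) y :: ennreal)"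
    if "y \<in> space (\<Pi>\<^sub>M c\<in>C. (lborel :: real measure))" for x y
  proof -
    let ?z = "lincomb (B \<union> C) (merge B C (x, y))"
    have 1: "?z \<bullet> b = x b" if "b \<in> B" for b
      using that onb_coord[OF BC(1), of b "merge B C (x, y)"] BC(2) by (auto simp: merge_def)
    have 2: "?z \<bullet> c = y c" if "c \<in> C" for c
      using that onb_coord[OF BC(1), of c "merge B C (x, y)"] BC(2) by (auto simp: merge_def)
    have "closest_point E ?z = lincomb B x"
      unfolding onb_closest_point[OF B] using 1 by (intro lincomb_cong) auto
    moreover have "y \<in> (\<Pi>\<^sub>E c\<in>C. {0..1}) \<longleftrightarrow> (\<forall>c\<in>C. 0 \<le> y c \<and> y c \<le> 1)"
      using that by (auto simp: PiE_iff space_PiM)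
    ultimately show ?thesis
      using 2 by (auto simp: slab_def indicator_def)
  qed
  have "emeasure lborel (slab E C A) = (\<integral>\<^sup>+x. indicator (slab E C A) x \<partial>basis_measure (B \<union> C) lborel)"
    by (subst (1) lborel_eq_basis_measure[OF BC(1)]) simp
  also have "\<dots> = (\<integral>\<^sup>+x. \<integral>\<^sup>+y. indicator (slab E C A) (lincomb (B \<union> C) (merge B C (x, y)))
      \<partial>(\<Pi>\<^sub>M c\<in>C. lborel) \<partial>(\<Pi>\<^sub>M b\<in>B. lborel))"
    using fin BC(2) by (subst nn_integral_basis_measure) (auto intro!: lborel_product.product_nn_integral_fold)
  also have "\<dots> = (\<integral>\<^sup>+x. \<integral>\<^sup>+y. indicator A (lincomb B x) * indicator (\<Pi>\<^sub>E c\<in>C. {0..1::real}) y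
      \<partial>(\<Pi>\<^sub>M c\<in>C. lborel) \<partial>(\<Pi>\<^sub>M b\<in>B. lborel))"
    by (intro nn_integral_cong *)
  also have "\<dots> = (\<integral>\<^sup>+x. indicator A (lincomb B x) * emeasure (\<Pi>\<^sub>M c\<in>C. lborel) (\<Pi>\<^sub>E c\<in>C. {0..1::real}) \<partial>(\<Pi>\<^sub>M b\<in>B. lborel))"
    using Cc by (intro nn_integral_cong) (simp add: nn_integral_cmult)
  also have "emeasure (\<Pi>\<^sub>M c\<in>C. lborel) (\<Pi>\<^sub>E c\<in>C. {0..1::real}) = 1"
    using fin by (subst lborel_product.emeasure_PiM) auto
  also have "(\<integral>\<^sup>+x. indicator A (lincomb B x) * 1 \<partial>(\<Pi>\<^sub>M b\<in>B. lborel)) = emeasure (subspace_lborel E) A"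
    by (simp add: subspace_lborel_eq[OF B] flip: nn_integral_basis_measure)
  finally show ?thesis ..
qed

lemma sets_subspace_lborel [measurable_cong, simp]: "sets (subspace_lborel E) = sets borel"
  by (simp add: subspace_lborel_def Let_def)

lemma space_subspace_lborel [simp]: "space (subspace_lborel E) = UNIV"
  by (simp add: subspace_lborel_def Let_def)

lemma sigma_finite_subspace_lborel:
  "subspace E \<Longrightarrow> sigma_finite_measure (subspace_lborel E)"
  by (metis orthonormal_basis_exists sigma_finite_basis_measure subspace_lborel_eq)

lemma AE_subspace_lborel:
  assumes "subspace E"
  shows "AE x in subspace_lborel E. x \<in> E"
proof -
  obtain B where B: "orthonormal_basis E B"
    using assms orthonormal_basis_exists by blast
  show ?thesis
    using AE_basis_measure_span[of lborel B] unfolding subspace_lborel_eq[OF B] by (simp add: onb_span[OF B])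
qed

text \<open>A point of the slab has projection of norm at most \<open>R\<close> and at most
  \<open>DIM('a)\<close> further coordinates in \<open>{0..1}\<close>. The bound does not depend on
  \<open>E\<close>, so it can later dominate integrals over a varying hyperplane.\<close>

lemma emeasure_subspace_lborel_cball:
  fixes E :: "'a::euclidean_space set"
  assumes "subspace E"
  shows "emeasure (subspace_lborel E) (cball 0 R) \<le> emeasure lborel (cball (0::'a) (R + DIM('a)))"
proof -
  obtain B where B: "orthonormal_basis E B"
    using assms orthonormal_basis_exists by blast
  obtain C where C: "B \<inter> C = {}" "orthonormal_basis UNIV (B \<union> C)"
    using onb_extend[OF B subspace_UNIV] by auto
  have fin: "finite (B \<union> C)" using onb_finite[OF C(2)] .
  have "card C \<le> DIM('a)"
    using onb_card[OF C(2)] card_mono[OF fin, of C] by (simp add: dim_UNIV)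
  have "norm x \<le> R + DIM('a)" if x: "x \<in> slab E C (cball 0 R)" for x
  proof -
    have "x = lincomb (B \<union> C) (\<lambda>b. x \<bullet> b)"
      using onb_expand[OF C(2), of x] by simp
    also have "\<dots> = lincomb B (\<lambda>b. x \<bullet> b) + lincomb C (\<lambda>b. x \<bullet> b)"
      using fin C(1) unfolding lincomb_def by (intro sum.union_disjoint) auto
    also have "norm \<dots> \<le> norm (lincomb B (\<lambda>b. x \<bullet> b)) + norm (lincomb C (\<lambda>b. x \<bullet> b))"
      by (rule norm_triangle_ineq)
    also have "norm (lincomb B (\<lambda>b. x \<bullet> b)) \<le> R"
      using x by (simp add: slab_def onb_closest_point[OF B])
    also have "norm (lincomb C (\<lambda>b. x \<bullet> b)) \<le> (\<Sum>c\<in>C. 1)"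
      unfolding lincomb_def using x C(2)
      by (intro sum_norm_le) (auto simp: slab_def orthonormal_basis_def)
    also have "(\<Sum>c\<in>C. 1) \<le> real DIM('a)"
      using \<open>card C \<le> DIM('a)\<close> by simp
    finally show ?thesis by simp
  qed
  then have "slab E C (cball 0 R) \<subseteq> cball 0 (R + DIM('a))" by auto
  then show ?thesis
    by (subst emeasure_subspace_lborel_slab[OF B C(2,1)]) (auto intro!: emeasure_mono)
qed

lemma finite_emeasure_subspace_lborel_cball:
  assumes "subspace E"
  shows "emeasure (subspace_lborel E) (cball 0 R) < \<infinity>"
  using le_less_trans[OF emeasure_subspace_lborel_cball[OF assms] emeasure_bounded_finite[OF bounded_cball]] .

lemma measure_subspace_lborel_cball:
  fixes E :: "'a::euclidean_space set"
  assumes "subspace E"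
  shows "measure (subspace_lborel E) (cball 0 R) \<le> measure lborel (cball (0::'a) (R + DIM('a)))"
  unfolding measure_def
  using emeasure_subspace_lborel_cball[OF assms, of R]
    emeasure_bounded_finite[OF bounded_cball, of "0::'a" "R + DIM('a)"]
  by (intro enn2real_mono) auto

lemma integrable_subspace_lborel:
  fixes f :: "'a::euclidean_space \<Rightarrow> real"
  assumes "subspace E" and "f \<in> borel_measurable borel"
    and "\<And>x. \<bar>f x\<bar> \<le> K * indicator (cball 0 R) x"
  shows "integrable (subspace_lborel E) f"
proof (rule Bochner_Integration.integrable_bound)
  show "integrable (subspace_lborel E) (\<lambda>x. K * indicator (cball 0 R) x)"
    using finite_emeasure_subspace_lborel_cball[OF assms(1), of R] by simp
  show "f \<in> borel_measurable (subspace_lborel E)"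
    using assms(2) by simp
  show "AE x in subspace_lborel E. norm (f x) \<le> norm (K * indicator (cball 0 R) x)"
    using order_trans[OF assms(3) abs_ge_self] by auto
qed

text \<open>Projection onto \<open>E\<close> commutes with scaling, so the slab over
  \<open>A\<close> also meets every ray from the origin at most once; such closed sets are
  negligible.\<close>

lemma null_sets_subspace_lborel_starlike:
  fixes E :: "'a::euclidean_space set"
  assumes "subspace E" "closed A" and star: "\<And>c x. c *\<^sub>R x \<in> A \<Longrightarrow> 0 \<le> c \<Longrightarrow> x \<in> A \<Longrightarrow> c = 1"
  shows "A \<in> null_sets (subspace_lborel E)"
proof -
  obtain B where B: "orthonormal_basis E B"
    using assms orthonormal_basis_exists by blast
  obtain C where C: "B \<inter> C = {}" "orthonormal_basis UNIV (B \<union> C)"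
    using onb_extend[OF B subspace_UNIV] by auto
  have A [measurable]: "A \<in> sets borel" using assms by simp
  have "finite C" using onb_finite[OF C(2)] by simp
  have cont: "continuous_on UNIV (closest_point E)"
    using assms(1) by (rule continuous_on_closest_point_subspace)
  have "slab E C A = closest_point E -` A \<inter> (\<Inter>c\<in>C. {x. 0 \<le> x \<bullet> c} \<inter> {x. x \<bullet> c \<le> 1})"
    by (auto simp: slab_def)
  moreover have "closed (\<Inter>c\<in>C. {x. 0 \<le> x \<bullet> c} \<inter> {x. x \<bullet> c \<le> 1})"
    by (intro closed_INT ballI closed_Int closed_Collect_le continuous_intros)
  ultimately have cl: "closed (slab E C A)"
    using closed_vimage[OF \<open>closed A\<close> cont] by auto
  have "negligible (slab E C A)"
  proof (rule starlike_negligible[OF cl, of 0])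
    fix c x assume "0 + c *\<^sub>R x \<in> slab E C A" "0 \<le> c" "0 + x \<in> slab E C A"
    moreover have "closest_point E (c *\<^sub>R x) = c *\<^sub>R closest_point E x"
      by (simp add: onb_closest_point[OF B] lincomb_scale)
    ultimately show "c = 1"
      using star by (auto simp: slab_def)
  qed
  then have "emeasure lborel (slab E C A) = 0"
    using slab_borel[OF assms(1) \<open>finite C\<close> A]
    by (simp add: negligible_iff_null_sets null_sets_def)
  then show ?thesis
    using emeasure_subspace_lborel_slab[OF B C(2,1) A] by (simp add: null_sets_def)
qed

text \<open>The slab over the ball contains a nonempty open set, obtained by making the cube
  inequalities strict.\<close>

lemma emeasure_subspace_lborel_ball_pos:
  fixes E :: "'a::euclidean_space set"
  assumes "subspace E" "y \<in> E" "0 < d"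
  shows "0 < emeasure (subspace_lborel E) (ball y d)"
proof -
  obtain B where B: "orthonormal_basis E B"
    using assms orthonormal_basis_exists by blast
  obtain C where C: "B \<inter> C = {}" "orthonormal_basis UNIV (B \<union> C)"
    using onb_extend[OF B subspace_UNIV] by auto
  have "finite C" using onb_finite[OF C(2)] by simp
  have cont: "continuous_on UNIV (closest_point E)"
    using assms(1) by (rule continuous_on_closest_point_subspace)
  define V where "V = closest_point E -` ball y d \<inter> (\<Inter>c\<in>C. {x. 0 < x \<bullet> c} \<inter> {x. x \<bullet> c < 1})"
  have "open (\<Inter>c\<in>C. {x. 0 < x \<bullet> c} \<inter> {x. x \<bullet> c < 1})"
    using \<open>finite C\<close> by (intro open_INT ballI open_Int open_Collect_less continuous_intros)
  then have "open V"
    unfolding V_def using open_vimage[OF open_ball cont] by blast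
  \<comment> \<open>The point over \<open>y\<close> at the centre of the unit cube.\<close>
  let ?z = "lincomb (B \<union> C) (\<lambda>b. if b \<in> B then y \<bullet> b else 1 / 2)"
  have zb: "?z \<bullet> b = (if b \<in> B then y \<bullet> b else 1 / 2)" if "b \<in> B \<union> C" for b
    using that by (rule onb_coord[OF C(2)])
  have "closest_point E ?z = lincomb B (\<lambda>b. y \<bullet> b)"
    unfolding onb_closest_point[OF B] using zb by (intro lincomb_cong) auto
  then have "closest_point E ?z = y"
    using onb_expand[OF B assms(2)] by simp
  moreover have "0 < ?z \<bullet> c \<and> ?z \<bullet> c < 1" if "c \<in> C" for c
    using zb[of c] that C(1) by auto
  ultimately have "?z \<in> V"
    using assms(3) by (auto simp: V_def)
  then have "\<not> negligible V"
    using open_not_negligible[OF \<open>open V\<close>] by blast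
  then have "emeasure lborel V \<noteq> 0"
    using \<open>open V\<close> by (simp add: negligible_iff_null_sets null_sets_def)
  moreover have "emeasure lborel V \<le> emeasure lborel (slab E C (ball y d))"
    using slab_borel[OF assms(1) \<open>finite C\<close>, of "ball y d"]
    by (intro emeasure_mono) (auto simp: V_def slab_def less_imp_le)
  ultimately show ?thesis
    using emeasure_subspace_lborel_slab[OF B C(2,1), of "ball y d"] by (auto simp: zero_less_iff_neq_zero)
qed

text \<open>Fubini along one basis direction; it is applied with \<open>e\<close> the unit normal of
  a hyperplane in \<open>H\<close>.\<close>

lemma integral_basis_measure_insert:
  fixes f :: "'a::euclidean_space \<Rightarrow> real"
  assumes "finite B" "e \<notin> B" and f: "integrable (basis_measure (insert e B) lborel) f"
  shows "(\<integral>x. f x \<partial>basis_measure (insert e B) lborel)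
       = (\<integral>y. \<integral>t. f (y + t *\<^sub>R e) \<partial>lborel \<partial>basis_measure B lborel)"
proof -
  have [measurable]: "f \<in> borel_measurable borel"
    using borel_measurable_integrable[OF f] by simp
  have eq: "lincomb (insert e B) (c(e := t)) = lincomb B c + t *\<^sub>R e" for c t
    using assms(1,2) unfolding lincomb_def by (auto simp: add.commute intro!: sum.cong)
  have int: "integrable (\<Pi>\<^sub>M b\<in>insert e B. lborel) (\<lambda>c. f (lincomb (insert e B) c))"
    using f unfolding basis_measure_def by (subst (asm) integrable_distr_eq) auto
  have "(\<integral>x. f x \<partial>basis_measure (insert e B) lborel)
      = (\<integral>c. f (lincomb (insert e B) c) \<partial>(\<Pi>\<^sub>M b\<in>insert e B. lborel))"
    unfolding basis_measure_def by (subst integral_distr) auto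
  also have "\<dots> = (\<integral>c. \<integral>t. f (lincomb B c + t *\<^sub>R e) \<partial>lborel \<partial>(\<Pi>\<^sub>M b\<in>B. lborel))"
    using lborel_product.product_integral_insert[OF assms(1,2) int] by (simp add: eq)
  also have "\<dots> = (\<integral>y. \<integral>t. f (y + t *\<^sub>R e) \<partial>lborel \<partial>basis_measure B lborel)"
    unfolding basis_measure_def by (subst integral_distr) auto
  finally show ?thesis .
qed

section \<open>Gaussian averages\<close>

lemma has_bochner_integral_gaussian:
  fixes a b c :: real
  assumes "0 < a"
  shows "has_bochner_integral lborel (\<lambda>s. exp (- ((a * s\<^sup>2 + 2 * b * s + c) / 2)))
    (sqrt (2 * pi / a) * exp (- ((c - b\<^sup>2 / a) / 2)))"
proof -
  let ?K = "sqrt (2 * pi / a) * exp (- ((c - b\<^sup>2 / a) / 2))"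
  have "exp (- ((a * s\<^sup>2 + 2 * b * s + c) / 2)) = ?K * normal_density (- b / a) (1 / sqrt a) s" for s
  proof -
    \<comment> \<open>Completing the square.\<close>
    have "a * s\<^sup>2 + 2 * b * s + c = (c - b\<^sup>2 / a) + (s + b / a)\<^sup>2 * a"
      using assms by (simp add: power2_eq_square field_simps)
    then have "- ((a * s\<^sup>2 + 2 * b * s + c) / 2) = - ((c - b\<^sup>2 / a) / 2) + - ((s + b / a)\<^sup>2 * a / 2)"
      by (simp only: add_divide_distrib minus_add_distrib)
    then have "exp (- ((a * s\<^sup>2 + 2 * b * s + c) / 2))
        = exp (- ((c - b\<^sup>2 / a) / 2)) * exp (- ((s + b / a)\<^sup>2 * a / 2))"
      by (simp only: exp_add)
    also have "exp (- ((s + b / a)\<^sup>2 * a / 2)) = sqrt (2 * pi / a) * normal_density (- b / a) (1 / sqrt a) s"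
      using assms by (simp add: normal_density_def power_divide)
    finally show ?thesis by (simp add: mult_ac)
  qed
  moreover have "has_bochner_integral lborel (\<lambda>s. ?K * normal_density (- b / a) (1 / sqrt a) s) (?K * 1)"
    using assms by (intro has_bochner_integral_mult_right) (simp add: has_bochner_integral_iff)
  ultimately show ?thesis by simp
qed

text \<open>The singularity at \<open>0\<close> is of order \<open>-1/2\<close> and hence
  integrable; for \<open>\<bar>t\<bar> > 1\<close> the density itself dominates. The majorant adds
  both half-interval singularities and the density.\<close>

lemma integrable_inverse_sqrt_std_normal:
  "integrable std_normal_distribution (\<lambda>t. 1 / sqrt \<bar>t\<bar>)"
proof -
  let ?f = "\<lambda>t::real. indicator {0..1} t * (1 / sqrt \<bar>t\<bar>)"
  have "(\<lambda>t::real. t powr (- 1 / 2)) absolutely_integrable_on {0..1}"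
    using integrable_on_powr_from_0[of "- 1 / 2" 1]
    by (intro nonnegative_absolutely_integrable_1) auto
  then have "integrable lebesgue (\<lambda>t::real. indicator {0..1} t *\<^sub>R t powr (- 1 / 2))"
    unfolding set_integrable_def .
  \<comment> \<open>At \<open>t = 0\<close> both sides are \<open>0\<close>, by the conventions for
    \<open>powr\<close> and for division by zero.\<close>
  also have "(\<lambda>t::real. indicator {0..1} t *\<^sub>R t powr (- 1 / 2)) = ?f"
    by (intro ext) (auto simp: indicator_def powr_minus powr_half_sqrt divide_simps)
  finally have "integrable lebesgue ?f" .
  then have f: "integrable lborel ?f"
    by (subst (asm) integrable_completion) auto
  then have f': "integrable lborel (\<lambda>t. ?f (- t))"
    using lborel_integrable_real_affine_iff[of "-1" ?f 0] by simp
  have "integrable lborel (\<lambda>t. ?f t + ?f (- t) + std_normal_density t)"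
    using f f' by (intro Bochner_Integration.integrable_add) auto
  then have "integrable lborel (\<lambda>t. std_normal_density t *\<^sub>R (1 / sqrt \<bar>t\<bar>))"
  proof (rule Bochner_Integration.integrable_bound)
    have "norm (std_normal_density t *\<^sub>R (1 / sqrt \<bar>t\<bar>)) \<le> norm (?f t + ?f (- t) + std_normal_density t)" for t
    proof -
      have le1: "std_normal_density t \<le> 1"
      proof -
        have "1 \<le> sqrt (2 * pi)" using pi_gt3 by simp
        then have "1 / sqrt (2 * pi) \<le> 1" by simp
        moreover have "exp (- t\<^sup>2 / 2) \<le> 1" by simp
        ultimately show ?thesis
          unfolding std_normal_density_def by (intro mult_le_one) auto
      qed
      have nn: "0 \<le> ?f t" "0 \<le> ?f (- t)" "0 \<le> std_normal_density t" "0 \<le> std_normal_density t * (1 / sqrt \<bar>t\<bar>)"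
        by (auto simp: indicator_def)
      have "std_normal_density t * (1 / sqrt \<bar>t\<bar>) \<le> ?f t + ?f (- t) + std_normal_density t"
      proof (cases "\<bar>t\<bar> \<le> 1")
        case True
        have "std_normal_density t * (1 / sqrt \<bar>t\<bar>) \<le> 1 / sqrt \<bar>t\<bar>"
          using le1 by (intro mult_left_le_one_le) auto
        also have "\<dots> \<le> ?f t + ?f (- t)"
          using True by (auto simp: indicator_def)
        finally show ?thesis using nn(3) by linarith
      next
        case False
        then have "1 / sqrt \<bar>t\<bar> \<le> 1" by simp
        then have "std_normal_density t * (1 / sqrt \<bar>t\<bar>) \<le> std_normal_density t"
          by (intro mult_left_le) auto
        then show ?thesis using nn by linarith
      qed
      then show ?thesis
        using nn by (simp only: real_norm_def real_scaleR_def abs_of_nonneg add_nonneg_nonneg)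
    qed
    then show "AE t in lborel. norm (std_normal_density t *\<^sub>R (1 / sqrt \<bar>t\<bar>)) \<le> norm (?f t + ?f (- t) + std_normal_density t)"
      by simp
  qed measurable
  then show ?thesis
    by (subst integrable_density) auto
qed

section \<open>Standard Gaussian vectors in a subspace\<close>

interpretation std_normal: prob_space std_normal_distribution
  using real_dist_normal_dist by (simp add: real_distribution_def)

interpretation std_normal_product: product_sigma_finite "\<lambda>_. std_normal_distribution" ..

lemma prob_space_gaussian: "prob_space (basis_measure B std_normal_distribution)"
proof -
  interpret prob_space "\<Pi>\<^sub>M b\<in>B. std_normal_distribution"
    by (intro prob_space_PiM std_normal.prob_space_axioms)
  show ?thesis
    unfolding basis_measure_def by (intro prob_space_distr) auto
qed

text \<open>The coordinates are independent, so the characteristic function is a product of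
  one-dimensional ones; \<open>v \<in> E\<close> ensures that the coordinates of \<open>v\<close>
  carry its full norm.\<close>

lemma char_gaussian:
  assumes B: "orthonormal_basis E B" and "v \<in> E"
  shows "(\<integral>\<xi>. iexp (\<xi> \<bullet> v) \<partial>basis_measure B std_normal_distribution) = exp (- ((norm v)\<^sup>2 / 2))"
proof -
  have fin: "finite B" using B by (rule onb_finite)
  have "(\<integral>\<xi>. iexp (\<xi> \<bullet> v) \<partial>basis_measure B std_normal_distribution)
      = (\<integral>c. iexp (lincomb B c \<bullet> v) \<partial>(\<Pi>\<^sub>M b\<in>B. std_normal_distribution))"
    unfolding basis_measure_def by (subst integral_distr) auto
  also have "\<dots> = (\<integral>c. (\<Prod>b\<in>B. iexp ((v \<bullet> b) * c b)) \<partial>(\<Pi>\<^sub>M b\<in>B. std_normal_distribution))"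
    by (simp add: inner_commute[of _ v] inner_lincomb sum_distrib_left exp_sum[OF fin, symmetric] mult_ac)
  also have "\<dots> = (\<Prod>b\<in>B. \<integral>t. iexp ((v \<bullet> b) * t) \<partial>std_normal_distribution)"
    by (intro std_normal_product.product_integral_prod fin std_normal.integrable_const_bound[where B=1]) auto
  also have "\<dots> = (\<Prod>b\<in>B. complex_of_real (exp (- (v \<bullet> b)\<^sup>2 / 2)))"
    using char_std_normal_distribution by (simp add: char_def fun_eq_iff)
  also have "\<dots> = exp (- ((\<Sum>b\<in>B. (v \<bullet> b)\<^sup>2) / 2))"
    by (simp add: exp_sum[OF fin, symmetric] sum_negf sum_divide_distrib flip: of_real_prod)
  also have "(\<Sum>b\<in>B. (v \<bullet> b)\<^sup>2) = (norm v)\<^sup>2"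
    unfolding power2_norm_eq_inner using onb_inner_expand[OF B \<open>v \<in> E\<close>, of v]
    by (simp only: power2_eq_square)
  finally show ?thesis .
qed

text \<open>The Gaussian in \<open>\<xi> \<bullet> y\<close> is itself a Gaussian average over \<open>u\<close> of characters
  \<open>iexp (u * n * (\<xi> \<bullet> y))\<close>, so that only \<open>char_gaussian\<close> at \<open>x + u * n * y\<close> is needed.\<close>

lemma gaussian_cos_integral:
  fixes n :: real
  assumes B: "orthonormal_basis E B" and "x \<in> E" "y \<in> E"
  shows "(\<integral>\<xi>. cos (\<xi> \<bullet> x) * exp (- ((n * (\<xi> \<bullet> y))\<^sup>2 / 2)) \<partial>basis_measure B std_normal_distribution)
    = 1 / sqrt (1 + n\<^sup>2 * (norm y)\<^sup>2) *
      exp (- (((norm x)\<^sup>2 - n\<^sup>2 * (x \<bullet> y)\<^sup>2 / (1 + n\<^sup>2 * (norm y)\<^sup>2)) / 2))"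
proof -
  let ?N = "basis_measure B std_normal_distribution"
  let ?a = "1 + n\<^sup>2 * (norm y)\<^sup>2"
  interpret N: prob_space ?N by (rule prob_space_gaussian)
  interpret P: pair_prob_space ?N std_normal_distribution ..
  have vE: "x + (u * n) *\<^sub>R y \<in> E" for u
    using assms onb_subspace subspace_add subspace_scale by blast
  have char: "(\<integral>u. iexp (t * u) \<partial>std_normal_distribution) = exp (- (t\<^sup>2 / 2))" for t
    using char_std_normal_distribution by (simp add: char_def fun_eq_iff)
  have a: "0 < ?a" by (simp add: add_pos_nonneg)
  have "complex_of_real (\<integral>\<xi>. cos (\<xi> \<bullet> x) * exp (- ((n * (\<xi> \<bullet> y))\<^sup>2 / 2)) \<partial>?N)
      = Re (\<integral>\<xi>. iexp (\<xi> \<bullet> x) * exp (- ((n * (\<xi> \<bullet> y))\<^sup>2 / 2)) \<partial>?N)"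
  proof (subst integral_Re[symmetric])
    show "integrable ?N (\<lambda>\<xi>. iexp (\<xi> \<bullet> x) * exp (- ((n * (\<xi> \<bullet> y))\<^sup>2 / 2)))"
      by (rule N.integrable_const_bound[where B=1]) (auto simp: norm_mult simp flip: exp_of_real)
  qed (simp add: Re_exp mult.commute[of _ "exp _"])
  also have "(\<integral>\<xi>. iexp (\<xi> \<bullet> x) * exp (- ((n * (\<xi> \<bullet> y))\<^sup>2 / 2)) \<partial>?N)
      = (\<integral>\<xi>. (\<integral>u. iexp (\<xi> \<bullet> (x + (u * n) *\<^sub>R y)) \<partial>std_normal_distribution) \<partial>?N)"
  proof (rule Bochner_Integration.integral_cong[OF refl])
    fix \<xi> :: 'a
    have "(\<integral>u. iexp (\<xi> \<bullet> (x + (u * n) *\<^sub>R y)) \<partial>std_normal_distribution)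
        = (\<integral>u. iexp (\<xi> \<bullet> x) * iexp ((n * (\<xi> \<bullet> y)) * u) \<partial>std_normal_distribution)"
      by (simp add: inner_add_right exp_add[symmetric] algebra_simps)
    also have "\<dots> = iexp (\<xi> \<bullet> x) * exp (- ((n * (\<xi> \<bullet> y))\<^sup>2 / 2))"
      by (simp only: integral_mult_right_zero char)
    finally show "iexp (\<xi> \<bullet> x) * exp (- ((n * (\<xi> \<bullet> y))\<^sup>2 / 2))
      = (\<integral>u. iexp (\<xi> \<bullet> (x + (u * n) *\<^sub>R y)) \<partial>std_normal_distribution)" by simp
  qed
  also have "\<dots> = (\<integral>u. (\<integral>\<xi>. iexp (\<xi> \<bullet> (x + (u * n) *\<^sub>R y)) \<partial>?N) \<partial>std_normal_distribution)"
    by (intro P.Fubini_integral[symmetric] P.integrable_const_bound[where B=1]) auto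
  also have "\<dots> = (\<integral>u. complex_of_real (exp (- ((norm (x + (u * n) *\<^sub>R y))\<^sup>2 / 2))) \<partial>std_normal_distribution)"
    by (simp add: char_gaussian[OF B vE])
  also have "\<dots> = (\<integral>u. exp (- ((norm (x + (u * n) *\<^sub>R y))\<^sup>2 / 2)) \<partial>std_normal_distribution)"
    by (rule integral_complex_of_real)
  also have "(\<integral>u. exp (- ((norm (x + (u * n) *\<^sub>R y))\<^sup>2 / 2)) \<partial>std_normal_distribution)
      = (\<integral>u. std_normal_density u *\<^sub>R exp (- ((norm (x + (u * n) *\<^sub>R y))\<^sup>2 / 2)) \<partial>lborel)"
    by (rule integral_density) auto
  \<comment> \<open>The density contributes \<open>u\<^sup>2\<close> to the exponent, which makes it
    a quadratic polynomial in \<open>u\<close> with leading coefficient \<open>?a\<close>.\<close>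
  also have "\<dots> = (\<integral>u. 1 / sqrt (2 * pi) * exp (- ((?a * u\<^sup>2 + 2 * (n * (x \<bullet> y)) * u + (norm x)\<^sup>2) / 2)) \<partial>lborel)"
  proof (rule Bochner_Integration.integral_cong[OF refl])
    fix u :: real
    have "?a * u\<^sup>2 + 2 * (n * (x \<bullet> y)) * u + (norm x)\<^sup>2 = u\<^sup>2 + (norm (x + (u * n) *\<^sub>R y))\<^sup>2"
      unfolding power2_norm_eq_inner inner_add_left inner_add_right inner_scaleR_left inner_scaleR_right inner_commute[of y x]
      by (simp add: power2_eq_square algebra_simps)
    then show "std_normal_density u *\<^sub>R exp (- ((norm (x + (u * n) *\<^sub>R y))\<^sup>2 / 2))
      = 1 / sqrt (2 * pi) * exp (- ((?a * u\<^sup>2 + 2 * (n * (x \<bullet> y)) * u + (norm x)\<^sup>2) / 2))"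
      by (simp add: std_normal_density_def exp_add[symmetric] add_divide_distrib)
  qed
  also have "\<dots> = 1 / sqrt (2 * pi) * (sqrt (2 * pi / ?a) * exp (- (((norm x)\<^sup>2 - (n * (x \<bullet> y))\<^sup>2 / ?a) / 2)))"
    using has_bochner_integral_gaussian[OF a, of "n * (x \<bullet> y)" "(norm x)\<^sup>2"]
    by (simp add: has_bochner_integral_iff)
  also have "\<dots> = 1 / sqrt ?a * exp (- (((norm x)\<^sup>2 - n\<^sup>2 * (x \<bullet> y)\<^sup>2 / ?a) / 2))"
    by (simp add: real_sqrt_divide power_mult_distrib)
  finally show ?thesis
    by (simp only: Re_complex_of_real of_real_eq_iff)
qed

lemma AE_gaussian_coord_nonzero:
  assumes B: "orthonormal_basis E B" and "b \<in> B"
  shows "AE \<xi> in basis_measure B std_normal_distribution. \<xi> \<bullet> b \<noteq> 0"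
proof -
  have "AE t in std_normal_distribution. t \<noteq> 0"
    by (subst AE_density) (auto intro: AE_mp[OF AE_lborel_singleton[of 0]])
  then have "AE c in (\<Pi>\<^sub>M b\<in>B. std_normal_distribution). c b \<noteq> 0"
    using assms(2) by (intro AE_PiM_component std_normal.prob_space_axioms)
  then show ?thesis
    unfolding basis_measure_def by (subst AE_distr_iff) (auto simp: onb_coord[OF assms])
qed

lemma AE_gaussian_in:
  "orthonormal_basis E B \<Longrightarrow> AE \<xi> in basis_measure B std_normal_distribution. \<xi> \<in> E"
  using AE_basis_measure_span[of std_normal_distribution B] onb_span[of E B] by simp

text \<open>With two coordinates \<open>s\<close>, \<open>t\<close> of \<open>\<xi>\<close> one has \<open>1 / norm \<xi> \<le> 1 / (sqrt \<bar>s\<bar> * sqrt \<bar>t\<bar>)\<close>.\<close>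

lemma integrable_inverse_norm_gaussian:
  assumes B: "orthonormal_basis E B" and "2 \<le> dim E"
  shows "integrable (basis_measure B std_normal_distribution) (\<lambda>\<xi>. 1 / norm \<xi>)"
proof -
  let ?N = "basis_measure B std_normal_distribution"
  have fin: "finite B" using B by (rule onb_finite)
  obtain p q where pq: "p \<in> B" "q \<in> B" "p \<noteq> q"
    using onb_card[OF B] assms(2) by (metis card_2_iff' card_le_Suc0_iff_eq fin not_less_eq_eq numeral_2_eq_2)
  \<comment> \<open>The constant factor 1 at the other coordinates turns the majorant into a product
    over all of \<open>B\<close>.\<close>
  define h where "h b t = (if b = p \<or> b = q then 1 / sqrt \<bar>t\<bar> else 1)" for b and t :: real
  have "integrable (\<Pi>\<^sub>M b\<in>B. std_normal_distribution) (\<lambda>c. \<Prod>b\<in>B. h b (c b))"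
  proof (rule std_normal_product.product_integrable_prod[OF fin])
    fix b show "integrable std_normal_distribution (h b)"
      unfolding h_def[abs_def] using integrable_inverse_sqrt_std_normal by (cases "b = p \<or> b = q") auto
  qed
  moreover have "(\<Prod>b\<in>B. h b (c b)) = 1 / sqrt \<bar>c p\<bar> * (1 / sqrt \<bar>c q\<bar>)" for c
  proof -
    have "(\<Prod>b\<in>B. h b (c b)) = (\<Prod>b\<in>{p, q}. h b (c b))"
      using pq fin by (intro prod.mono_neutral_right) (auto simp: h_def)
    then show ?thesis using pq by (simp add: h_def)
  qed
  ultimately have "integrable ?N (\<lambda>\<xi>. 1 / sqrt \<bar>\<xi> \<bullet> p\<bar> * (1 / sqrt \<bar>\<xi> \<bullet> q\<bar>))"
    unfolding basis_measure_def by (subst integrable_distr_eq) (auto simp: onb_coord[OF B] pq)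
  then show ?thesis
  proof (rule Bochner_Integration.integrable_bound)
    \<comment> \<open>If \<open>\<xi> \<bullet> p\<close> or \<open>\<xi> \<bullet> q\<close> is
      zero, division by zero makes the right side \<open>0\<close>; the estimate therefore holds
      only almost everywhere.\<close>
    show "AE \<xi> in ?N. norm (1 / norm \<xi>) \<le> norm (1 / sqrt \<bar>\<xi> \<bullet> p\<bar> * (1 / sqrt \<bar>\<xi> \<bullet> q\<bar>))"
      using AE_gaussian_coord_nonzero[OF B pq(1)] AE_gaussian_coord_nonzero[OF B pq(2)]
    proof eventually_elim
      case (elim \<xi>)
      have n: "norm p = 1" "norm q = 1" using B pq by (auto simp: orthonormal_basis_def)
      have "\<bar>\<xi> \<bullet> p\<bar> * \<bar>\<xi> \<bullet> q\<bar> \<le> norm \<xi> * norm \<xi>"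
        using Cauchy_Schwarz_ineq2[of \<xi> p] Cauchy_Schwarz_ineq2[of \<xi> q] n by (intro mult_mono) auto
      then have "sqrt \<bar>\<xi> \<bullet> p\<bar> * sqrt \<bar>\<xi> \<bullet> q\<bar> \<le> norm \<xi>"
        using real_sqrt_le_mono by (fastforce simp flip: real_sqrt_mult)
      moreover have "0 < sqrt \<bar>\<xi> \<bullet> p\<bar> * sqrt \<bar>\<xi> \<bullet> q\<bar>" using elim by simp
      ultimately have "1 / norm \<xi> \<le> 1 / (sqrt \<bar>\<xi> \<bullet> p\<bar> * sqrt \<bar>\<xi> \<bullet> q\<bar>)"
        by (intro frac_le zero_le_one order_refl)
      then show ?case by simp
    qed
  qed auto
qed

section \<open>Inversion of the Funk transform\<close>

lemma subspace_hyperplane_section: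
  "subspace H \<Longrightarrow> subspace {y \<in> H. y \<bullet> \<xi> = 0}"
  by (auto simp: subspace_def inner_add_left)

text \<open>Subtracting from \<open>y \<in> H\<close> its component along the unit normal leaves a
  vector of the hyperplane. The result splits integrals over \<open>H\<close> and also gives the
  dimension of the hyperplane.\<close>

lemma onb_insert_normal:
  fixes \<xi> :: "'a::euclidean_space"
  assumes H: "subspace H" and \<xi>: "\<xi> \<in> H" "\<xi> \<noteq> 0"
    and B: "orthonormal_basis {y \<in> H. y \<bullet> \<xi> = 0} B"
  shows "orthonormal_basis H (insert (\<xi> /\<^sub>R norm \<xi>) B)" "\<xi> /\<^sub>R norm \<xi> \<notin> B"
proof -
  let ?e = "\<xi> /\<^sub>R norm \<xi>"
  have orth: "b \<bullet> \<xi> = 0" if "b \<in> B" for b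
    using onb_in[OF B that] by auto
  have eH: "?e \<in> H" using H \<xi> by (simp add: subspace_scale)
  have e1: "norm ?e = 1" using \<xi> by simp
  show "?e \<notin> B" using orth[of ?e] \<xi> by auto
  have "span (insert ?e B) = H"
  proof
    show "span (insert ?e B) \<subseteq> H"
      using onb_in[OF B] eH H by (intro span_minimal) auto
    show "H \<subseteq> span (insert ?e B)"
    proof
      fix y assume "y \<in> H"
      have "(y - (y \<bullet> ?e) *\<^sub>R ?e) \<bullet> \<xi> = 0"
        using \<xi> by (simp add: inner_diff_left dot_square_norm power2_eq_square field_simps)
      then have "y - (y \<bullet> ?e) *\<^sub>R ?e \<in> span B"
        unfolding onb_span[OF B]
        by (intro CollectI conjI subspace_diff[OF H \<open>y \<in> H\<close> subspace_scale[OF H eH]])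
      then show "y \<in> span (insert ?e B)"
        unfolding span_insert by blast
    qed
  qed
  moreover have "pairwise orthogonal (insert ?e B)"
    using B orth by (auto simp: pairwise_insert orthonormal_basis_def orthogonal_def inner_commute)
  ultimately show "orthonormal_basis H (insert ?e B)"
    using B e1 unfolding orthonormal_basis_def by blast
qed

text \<open>\<open>J n\<close> is \<open>\<psi>\<close> integrated against an approximate identity of width
  \<open>1 / (n * norm \<xi>)\<close> transversal to the hyperplane \<open>{y \<in> H. y \<bullet> \<xi> = 0}\<close>.\<close>

lemma gaussian_hyperplane_integral:
  fixes \<psi> :: "'a::euclidean_space \<Rightarrow> real" and \<xi> :: 'a and R :: real
  assumes H: "subspace H" and \<xi>: "\<xi> \<in> H" "\<xi> \<noteq> 0"
    and [measurable]: "\<psi> \<in> borel_measurable borel"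
    and bnd: "\<And>y. \<bar>\<psi> y\<bar> \<le> indicator (cball 0 R) y"
  defines "E \<equiv> {y \<in> H. y \<bullet> \<xi> = 0}"
  defines "J \<equiv> \<lambda>n::real. n * (\<integral>y. \<psi> y * exp (- ((n * (\<xi> \<bullet> y))\<^sup>2 / 2)) \<partial>subspace_lborel H)"
  shows gaussian_hyperplane_bound:
      "0 < n \<Longrightarrow> \<bar>J n\<bar> \<le> measure lborel (cball (0::'a) (R + DIM('a))) * (sqrt (2 * pi) / norm \<xi>)"
    and gaussian_hyperplane_tendsto:
      "(AE y in subspace_lborel E. isCont \<psi> y) \<Longrightarrow> (\<integral>y. \<psi> y \<partial>subspace_lborel E) = 0 \<Longrightarrow>
        (\<lambda>n. J (real (Suc n))) \<longlonglongrightarrow> 0"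
proof -
  define e where "e = \<xi> /\<^sub>R norm \<xi>"
  have subE: "subspace E"
    unfolding E_def using H by (rule subspace_hyperplane_section)
  then obtain B where B: "orthonormal_basis E B"
    using orthonormal_basis_exists by blast
  have eB: "orthonormal_basis H (insert e B)" "e \<notin> B"
    using onb_insert_normal[OF H \<xi> B[unfolded E_def]] by (auto simp: e_def)
  have finB: "finite B" using B by (rule onb_finite)
  let ?\<mu> = "subspace_lborel E"
  let ?g = "\<lambda>u::real. exp (- ((norm \<xi> * u)\<^sup>2 / 2))"
  let ?c = "sqrt (2 * pi) / norm \<xi>"
  \<comment> \<open>Inner integral after the substitution \<open>t = u / n\<close>, which absorbs
    the factor \<open>n\<close> of \<open>J\<close> and makes the weight \<open>?g\<close>
    independent of \<open>n\<close>.\<close>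
  define G where "G n y = (\<integral>u. \<psi> (y + (u / n) *\<^sub>R e) * ?g u \<partial>lborel)" for n :: real and y
  interpret \<mu>: sigma_finite_measure ?\<mu> using subE by (rule sigma_finite_subspace_lborel)
  have c0: "0 \<le> ?c" by simp
  have g: "integrable lborel ?g" "(\<integral>u. ?g u \<partial>lborel) = ?c"
    using has_bochner_integral_gaussian[of "(norm \<xi>)\<^sup>2" 0 0] \<xi>
    by (auto simp: has_bochner_integral_iff power_mult_distrib real_sqrt_divide)
  have psi1: "\<bar>\<psi> y\<bar> \<le> 1" for y
    using order_trans[OF bnd indicator_le_1] .
  have \<xi>y: "\<xi> \<bullet> (y + t *\<^sub>R e) = norm \<xi> * t" if "y \<in> E" for y t
    using that \<xi> by (simp add: E_def e_def inner_add_right inner_commute[of y]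
        power2_norm_eq_inner[symmetric] power2_eq_square)
  \<comment> \<open>Since \<open>e\<close> is orthogonal to \<open>E\<close>, moving along
    \<open>e\<close> cannot decrease the norm; the support of \<open>\<psi>\<close> thus gives a
    bound independent of \<open>n\<close>.\<close>
  have Gbnd: "\<bar>G n y\<bar> \<le> ?c * indicator (cball 0 R) y" if "y \<in> E" for n y
  proof -
    have orth: "orthogonal y (t *\<^sub>R e)" for t
      using that by (simp add: E_def e_def orthogonal_def)
    have psib: "\<bar>\<psi> (y + t *\<^sub>R e)\<bar> \<le> indicator (cball 0 R) y" for t
    proof -
      have "(norm (y + t *\<^sub>R e))\<^sup>2 = (norm y)\<^sup>2 + (norm (t *\<^sub>R e))\<^sup>2"
        using orth by (rule norm_add_Pythagorean)
      then have "(norm y)\<^sup>2 \<le> (norm (y + t *\<^sub>R e))\<^sup>2"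
        by simp
      then have "norm y \<le> norm (y + t *\<^sub>R e)"
        by (rule power2_le_imp_le) simp
      then have "indicator (cball 0 R) (y + t *\<^sub>R e) \<le> (indicator (cball 0 R) y :: real)"
        by (simp add: indicator_def)
      then show ?thesis
        using bnd by (rule order_trans[rotated])
    qed
    have "\<bar>G n y\<bar> \<le> (\<integral>u. \<bar>\<psi> (y + (u / n) *\<^sub>R e) * ?g u\<bar> \<partial>lborel)"
      unfolding G_def by (rule integral_abs_bound)
    also have "\<dots> \<le> (\<integral>u. indicator (cball 0 R) y * ?g u \<partial>lborel)"
    proof (rule integral_mono_AE')
      show "integrable lborel (\<lambda>u. indicator (cball 0 R) y * ?g u)"
        using g(1) by simp
      show "AE u in lborel. \<bar>\<psi> (y + (u / n) *\<^sub>R e) * ?g u\<bar> \<le> indicator (cball 0 R) y * ?g u"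
        unfolding abs_mult by (intro AE_I2 mult_mono psib) auto
    qed simp
    also have "\<dots> = ?c * indicator (cball 0 R) y"
      unfolding integral_mult_right_zero g(2) by (rule mult.commute)
    finally show ?thesis .
  qed
  have [measurable]: "G n \<in> borel_measurable borel" for n
    unfolding G_def by measurable
  have J: "J n = (\<integral>y. G n y \<partial>?\<mu>)" if "0 < n" for n
  proof -
    let ?F = "\<lambda>y. \<psi> y * exp (- ((n * (\<xi> \<bullet> y))\<^sup>2 / 2))"
    have "integrable (subspace_lborel H) ?F"
    proof (rule integrable_subspace_lborel[OF H, where K=1 and R=R])
      fix y
      have "\<bar>?F y\<bar> \<le> \<bar>\<psi> y\<bar>" by (simp add: abs_mult mult_left_le)
      then show "\<bar>?F y\<bar> \<le> 1 * indicator (cball 0 R) y" using bnd[of y] by simp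
    qed measurable
    then have "(\<integral>y. ?F y \<partial>subspace_lborel H) = (\<integral>y. \<integral>t. ?F (y + t *\<^sub>R e) \<partial>lborel \<partial>?\<mu>)"
      unfolding subspace_lborel_eq[OF eB(1)] subspace_lborel_eq[OF B]
      by (rule integral_basis_measure_insert[OF finB eB(2)])
    then have "J n = (\<integral>y. n * (\<integral>t. ?F (y + t *\<^sub>R e) \<partial>lborel) \<partial>?\<mu>)"
      by (simp add: J_def)
    also have "\<dots> = (\<integral>y. G n y \<partial>?\<mu>)"
    proof (rule integral_cong_AE)
      show "AE y in ?\<mu>. n * (\<integral>t. ?F (y + t *\<^sub>R e) \<partial>lborel) = G n y"
        using AE_subspace_lborel[OF subE]
      proof eventually_elim
        case (elim y)
        have "(\<integral>t. ?F (y + t *\<^sub>R e) \<partial>lborel) = \<bar>1 / n\<bar> *\<^sub>R (\<integral>u. ?F (y + (0 + 1 / n * u) *\<^sub>R e) \<partial>lborel)"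
          using that by (intro lborel_integral_real_affine) auto
        also have "(\<lambda>u. ?F (y + (0 + 1 / n * u) *\<^sub>R e)) = (\<lambda>u. \<psi> (y + (u / n) *\<^sub>R e) * ?g u)"
          unfolding \<xi>y[OF elim] using that by simp
        finally show ?case using that by (simp add: G_def)
      qed
    qed measurable
    finally show ?thesis .
  qed
  show "\<bar>J n\<bar> \<le> measure lborel (cball (0::'a) (R + DIM('a))) * ?c" if "0 < n"
  proof -
    have "\<bar>J n\<bar> \<le> (\<integral>y. \<bar>G n y\<bar> \<partial>?\<mu>)"
      unfolding J[OF that] by (rule integral_abs_bound)
    also have "\<dots> \<le> (\<integral>y. ?c * indicator (cball 0 R) y \<partial>?\<mu>)"
    proof (rule integral_mono_AE')
      show "integrable ?\<mu> (\<lambda>y. ?c * indicator (cball 0 R) y)"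
        using finite_emeasure_subspace_lborel_cball[OF subE, of R] by simp
      show "AE y in ?\<mu>. \<bar>G n y\<bar> \<le> ?c * indicator (cball 0 R) y"
        using AE_subspace_lborel[OF subE] by eventually_elim (rule Gbnd)
    qed simp
    also have "\<dots> = ?c * measure ?\<mu> (cball 0 R)" by simp
    also have "\<dots> \<le> ?c * measure lborel (cball (0::'a) (R + DIM('a)))"
      using measure_subspace_lborel_cball[OF subE] c0 by (intro mult_left_mono)
    finally show ?thesis by (simp add: mult.commute)
  qed
  assume cont: "AE y in ?\<mu>. isCont \<psi> y" and 0: "(\<integral>y. \<psi> y \<partial>?\<mu>) = 0"
  \<comment> \<open>The argument of \<open>\<psi>\<close> tends to \<open>y\<close> for every fixed
    \<open>u\<close>, and \<open>?g\<close> dominates because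
    \<open>\<bar>\<psi>\<bar> \<le> 1\<close>.\<close>
  have Glim: "(\<lambda>n. G (real (Suc n)) y) \<longlonglongrightarrow> \<psi> y * ?c" if "isCont \<psi> y" for y
  proof -
    have "(\<lambda>n. G (real (Suc n)) y) \<longlonglongrightarrow> (\<integral>u. \<psi> y * ?g u \<partial>lborel)"
      unfolding G_def
    proof (rule integral_dominated_convergence[where w="?g"])
      show "AE u in lborel. (\<lambda>n. \<psi> (y + (u / real (Suc n)) *\<^sub>R e) * ?g u) \<longlonglongrightarrow> \<psi> y * ?g u"
      proof (intro AE_I2 tendsto_mult_right)
        fix u :: real
        have "(\<lambda>n. u * inverse (real (Suc n))) \<longlonglongrightarrow> u * 0"
          by (intro tendsto_mult_left LIMSEQ_inverse_real_of_nat)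
        then have "(\<lambda>n. y + (u / real (Suc n)) *\<^sub>R e) \<longlonglongrightarrow> y + 0 *\<^sub>R e"
          by (intro tendsto_intros) (simp add: divide_inverse)
        then show "(\<lambda>n. \<psi> (y + (u / real (Suc n)) *\<^sub>R e)) \<longlonglongrightarrow> \<psi> y"
          using that by (intro isCont_tendsto_compose[OF that]) simp
      qed
      show "AE u in lborel. norm (\<psi> (y + (u / real (Suc n)) *\<^sub>R e) * ?g u) \<le> ?g u" for n
        using psi1 by (auto simp: abs_mult intro!: mult_left_le_one_le)
    qed (use g in auto)
    then show ?thesis using g(2) by simp
  qed
  have "(\<lambda>n. \<integral>y. G (real (Suc n)) y \<partial>?\<mu>) \<longlonglongrightarrow> (\<integral>y. \<psi> y * ?c \<partial>?\<mu>)"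
  proof (rule integral_dominated_convergence[where w="\<lambda>y. ?c * indicator (cball 0 R) y"])
    show "AE y in ?\<mu>. (\<lambda>n. G (real (Suc n)) y) \<longlonglongrightarrow> \<psi> y * ?c"
      using cont by eventually_elim (rule Glim)
    show "AE y in ?\<mu>. norm (G (real (Suc n)) y) \<le> ?c * indicator (cball 0 R) y" for n
      using AE_subspace_lborel[OF subE] by eventually_elim (use Gbnd in simp)
    show "integrable ?\<mu> (\<lambda>y. ?c * indicator (cball 0 R) y)"
      using finite_emeasure_subspace_lborel_cball[OF subE, of R] by simp
  qed measurable
  then show "(\<lambda>n. J (real (Suc n))) \<longlonglongrightarrow> 0"
    using 0 J by simp
qed

text \<open>The double integral of \<open>?f\<close> is evaluated in both orders. Integrating over
  \<open>\<xi>\<close> first gives the kernel \<open>L k\<close>; integrating over \<open>y\<close>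
  first gives \<open>J k\<close>, which tends to \<open>0\<close> by the hyperplane hypothesis. Then
  \<open>k\<close> goes to infinity on both sides.\<close>

lemma funk_kernel_integral_eq_0:
  fixes \<psi> :: "'a::euclidean_space \<Rightarrow> real"
  assumes H: "subspace H" "2 \<le> dim H" and "0 < r" "x \<in> H"
    and [measurable]: "\<psi> \<in> borel_measurable borel"
    and bnd: "\<And>y. \<bar>\<psi> y\<bar> \<le> indicator (cball 0 R) y" and near0: "\<And>y. norm y < r \<Longrightarrow> \<psi> y = 0"
    and cont: "\<And>\<xi>. \<xi> \<in> H \<Longrightarrow> \<xi> \<noteq> 0 \<Longrightarrow> AE y in subspace_lborel {y \<in> H. y \<bullet> \<xi> = 0}. isCont \<psi> y"
    and int0: "\<And>\<xi>. \<xi> \<in> H \<Longrightarrow> \<xi> \<noteq> 0 \<Longrightarrow> (\<integral>y. \<psi> y \<partial>subspace_lborel {y \<in> H. y \<bullet> \<xi> = 0}) = 0"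
  shows "(\<integral>y. \<psi> y / norm y * exp (- (((norm x)\<^sup>2 - (x \<bullet> y)\<^sup>2 / (norm y)\<^sup>2) / 2)) \<partial>subspace_lborel H) = 0"
proof -
  obtain B where B: "orthonormal_basis H B"
    using H orthonormal_basis_exists by blast
  let ?\<mu> = "subspace_lborel H" and ?N = "basis_measure B std_normal_distribution"
  interpret \<mu>: sigma_finite_measure ?\<mu> using H(1) by (rule sigma_finite_subspace_lborel)
  interpret N: prob_space ?N by (rule prob_space_gaussian)
  interpret P: pair_sigma_finite ?\<mu> ?N ..
  define n where "n k = real (Suc k)" for k
  \<comment> \<open>This quantity tends to \<open>1 / (norm y)\<^sup>2\<close> and carries the whole
    dependence of the kernel on \<open>n k\<close>, both in the exponent and, as
    \<open>sqrt (m k y)\<close>, in the prefactor.\<close>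
  define m where "m k y = (n k)\<^sup>2 / (1 + (n k)\<^sup>2 * (norm y)\<^sup>2)" for k and y :: 'a
  define L where "L k y = sqrt (m k y) * exp (- (((norm x)\<^sup>2 - m k y * (x \<bullet> y)\<^sup>2) / 2))" for k y
  define J where "J k \<xi> = n k * (\<integral>y. \<psi> y * exp (- ((n k * (\<xi> \<bullet> y))\<^sup>2 / 2)) \<partial>?\<mu>)" for k \<xi>
  let ?K = "measure lborel (cball (0::'a) (R + DIM('a)))"
  have npos: "0 < n k" for k by (simp add: n_def)
  have [measurable]: "L k \<in> borel_measurable borel" for k
    unfolding L_def m_def by measurable
  have [measurable]: "J k \<in> borel_measurable borel" for k
    unfolding J_def by measurable
  have eq: "(\<integral>y. \<psi> y * L k y \<partial>?\<mu>) = (\<integral>\<xi>. cos (\<xi> \<bullet> x) * J k \<xi> \<partial>?N)" for k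
  proof -
    let ?f = "\<lambda>y \<xi>. n k * (\<psi> y * (cos (\<xi> \<bullet> x) * exp (- ((n k * (\<xi> \<bullet> y))\<^sup>2 / 2))))"
    have int: "integrable (?\<mu> \<Otimes>\<^sub>M ?N) (case_prod ?f)"
    proof (rule Bochner_Integration.integrable_bound)
      have "emeasure (?\<mu> \<Otimes>\<^sub>M ?N) (cball 0 R \<times> UNIV) < \<infinity>"
        using finite_emeasure_subspace_lborel_cball[OF H(1), of R] N.emeasure_space_1
        by (subst N.emeasure_pair_measure_Times) auto
      then show "integrable (?\<mu> \<Otimes>\<^sub>M ?N) (\<lambda>z. n k * indicator (cball 0 R \<times> UNIV) z)"
        by (intro integrable_mult_right integrable_real_indicator) auto
      have "\<bar>?f y \<xi>\<bar> \<le> n k * indicator (cball 0 R) y" for y \<xi>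
      proof -
        have "\<bar>cos (\<xi> \<bullet> x) * exp (- ((n k * (\<xi> \<bullet> y))\<^sup>2 / 2))\<bar> \<le> 1"
          unfolding abs_mult by (intro mult_le_one) auto
        then have "\<bar>\<psi> y\<bar> * \<bar>cos (\<xi> \<bullet> x) * exp (- ((n k * (\<xi> \<bullet> y))\<^sup>2 / 2))\<bar> \<le> indicator (cball 0 R) y * 1"
          using bnd[of y] by (intro mult_mono) auto
        then show ?thesis
          using npos[of k] unfolding abs_mult[of "n k"] abs_mult[of "\<psi> y"] by (intro mult_mono) auto
      qed
      then show "AE z in ?\<mu> \<Otimes>\<^sub>M ?N. norm (case_prod ?f z) \<le> norm (n k * indicator (cball 0 R \<times> UNIV) z)"
        using npos[of k] by (intro AE_I2) (auto simp: indicator_times split: prod.splits)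
    qed measurable
    have "(\<integral>\<xi>. cos (\<xi> \<bullet> x) * J k \<xi> \<partial>?N) = (\<integral>\<xi>. (\<integral>y. ?f y \<xi> \<partial>?\<mu>) \<partial>?N)"
      by (simp add: J_def mult_ac flip: integral_mult_right_zero)
    also have "\<dots> = (\<integral>y. (\<integral>\<xi>. ?f y \<xi> \<partial>?N) \<partial>?\<mu>)"
      by (rule P.Fubini_integral[OF int])
    also have "\<dots> = (\<integral>y. \<psi> y * L k y \<partial>?\<mu>)"
    proof (rule integral_cong_AE)
      show "AE y in ?\<mu>. (\<integral>\<xi>. ?f y \<xi> \<partial>?N) = \<psi> y * L k y"
        using AE_subspace_lborel[OF H(1)]
      proof eventually_elim
        case (elim y)
        have "n k / sqrt (1 + (n k)\<^sup>2 * (norm y)\<^sup>2) = sqrt (m k y)"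
          using npos[of k] by (simp add: m_def real_sqrt_divide)
        then have "L k y = n k / sqrt (1 + (n k)\<^sup>2 * (norm y)\<^sup>2) *
            exp (- (((norm x)\<^sup>2 - (n k)\<^sup>2 * (x \<bullet> y)\<^sup>2 / (1 + (n k)\<^sup>2 * (norm y)\<^sup>2)) / 2))"
          unfolding L_def by (simp add: m_def)
        then show ?case
          using gaussian_cos_integral[OF B \<open>x \<in> H\<close> elim, of "n k"] by simp
      qed
    qed measurable
    finally show ?thesis by simp
  qed
  \<comment> \<open>The dominating function is a multiple of \<open>1 / norm \<xi>\<close>,
    integrable because \<open>dim H\<close> is at least 2.\<close>
  have J0: "(\<lambda>k. \<integral>\<xi>. cos (\<xi> \<bullet> x) * J k \<xi> \<partial>?N) \<longlonglongrightarrow> (\<integral>\<xi>. 0 \<partial>?N)"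
  proof (rule integral_dominated_convergence[where w="\<lambda>\<xi>. ?K * (sqrt (2 * pi) / norm \<xi>)"])
    obtain b where "b \<in> B"
      using onb_card[OF B] H(2) by (metis card.empty ex_in_conv not_numeral_le_zero)
    from AE_gaussian_coord_nonzero[OF B this]
    have ne: "AE \<xi> in ?N. \<xi> \<noteq> 0" by eventually_elim auto
    show "AE \<xi> in ?N. (\<lambda>k. cos (\<xi> \<bullet> x) * J k \<xi>) \<longlonglongrightarrow> 0"
      using AE_gaussian_in[OF B] ne
    proof eventually_elim
      case (elim \<xi>)
      have "(\<lambda>k. cos (\<xi> \<bullet> x) * J k \<xi>) \<longlonglongrightarrow> cos (\<xi> \<bullet> x) * 0"
        unfolding J_def n_def using elim
        by (intro tendsto_mult_left gaussian_hyperplane_tendsto[OF H(1) _ _ _ bnd] cont int0) simp_all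
      then show ?case by simp
    qed
    show "AE \<xi> in ?N. norm (cos (\<xi> \<bullet> x) * J k \<xi>) \<le> ?K * (sqrt (2 * pi) / norm \<xi>)" for k
      using AE_gaussian_in[OF B] ne
    proof eventually_elim
      case (elim \<xi>)
      have "\<bar>cos (\<xi> \<bullet> x)\<bar> * \<bar>J k \<xi>\<bar> \<le> \<bar>J k \<xi>\<bar>"
        by (intro mult_left_le_one_le) auto
      also have "\<dots> \<le> ?K * (sqrt (2 * pi) / norm \<xi>)"
        unfolding J_def using elim npos by (intro gaussian_hyperplane_bound[OF H(1) _ _ _ bnd]) auto
      finally show ?case by (simp add: abs_mult)
    qed
    show "integrable ?N (\<lambda>\<xi>. ?K * (sqrt (2 * pi) / norm \<xi>))"
      using integrable_mult_right[OF integrable_inverse_norm_gaussian[OF B H(2)], of "?K * sqrt (2 * pi)"]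
      by simp
  qed measurable
  let ?L = "\<lambda>y. 1 / norm y * exp (- (((norm x)\<^sup>2 - (x \<bullet> y)\<^sup>2 / (norm y)\<^sup>2) / 2))"
  have Llim: "(\<lambda>k. L k y) \<longlonglongrightarrow> ?L y" if "y \<noteq> 0" for y
  proof -
    have "m k y = 1 / ((inverse (real (Suc k)))\<^sup>2 + (norm y)\<^sup>2)" for k
    proof -
      have "(inverse (n k))\<^sup>2 + (norm y)\<^sup>2 = (1 + (n k)\<^sup>2 * (norm y)\<^sup>2) / (n k)\<^sup>2"
        using npos[of k] by (simp add: power_inverse field_simps)
      then show ?thesis by (simp add: m_def n_def)
    qed
    moreover have "(\<lambda>k. 1 / ((inverse (real (Suc k)))\<^sup>2 + (norm y)\<^sup>2)) \<longlonglongrightarrow> 1 / (0\<^sup>2 + (norm y)\<^sup>2)"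
      using that by (intro tendsto_intros LIMSEQ_inverse_real_of_nat) auto
    ultimately have "(\<lambda>k. m k y) \<longlonglongrightarrow> 1 / (norm y)\<^sup>2" by simp
    then have "(\<lambda>k. L k y) \<longlonglongrightarrow> sqrt (1 / (norm y)\<^sup>2) * exp (- (((norm x)\<^sup>2 - 1 / (norm y)\<^sup>2 * (x \<bullet> y)\<^sup>2) / 2))"
      unfolding L_def by (intro tendsto_intros) simp_all
    then show ?thesis by (simp add: real_sqrt_divide)
  qed
  \<comment> \<open>The prefactor is at most \<open>1 / norm y\<close>, and Cauchy-Schwarz makes the
    exponent nonpositive. Since \<open>\<psi>\<close> vanishes on the ball of radius
    \<open>r\<close>, the singularity of the limit kernel at \<open>0\<close> does no harm.\<close>
  have Lbnd: "\<bar>L k y\<bar> \<le> 1 / r" if "r \<le> norm y" for k y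
  proof -
    have y0: "0 < norm y" using that \<open>0 < r\<close> by linarith
    have mpos: "0 \<le> m k y" by (simp add: m_def)
    have "m k y * (norm y)\<^sup>2 \<le> 1"
      by (simp add: m_def divide_simps add_pos_nonneg)
    then have m1: "m k y \<le> 1 / (norm y)\<^sup>2"
      using y0 by (simp add: field_simps)
    have "(x \<bullet> y)\<^sup>2 \<le> (norm x)\<^sup>2 * (norm y)\<^sup>2"
      using Cauchy_Schwarz_ineq[of x y] by (simp add: power2_norm_eq_inner)
    then have "m k y * (x \<bullet> y)\<^sup>2 \<le> m k y * ((norm x)\<^sup>2 * (norm y)\<^sup>2)"
      using mpos by (rule mult_left_mono)
    also have "\<dots> = (norm x)\<^sup>2 * (m k y * (norm y)\<^sup>2)" by simp
    also have "\<dots> \<le> (norm x)\<^sup>2"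
      using \<open>m k y * (norm y)\<^sup>2 \<le> 1\<close> mpos by (intro mult_left_le) auto
    finally have ex: "exp (- (((norm x)\<^sup>2 - m k y * (x \<bullet> y)\<^sup>2) / 2)) \<le> 1" by simp
    have "\<bar>L k y\<bar> = sqrt (m k y) * exp (- (((norm x)\<^sup>2 - m k y * (x \<bullet> y)\<^sup>2) / 2))"
      using mpos by (simp add: L_def abs_mult)
    also have "\<dots> \<le> sqrt (m k y)"
      using ex mpos by (intro mult_left_le) auto
    also have "\<dots> \<le> sqrt (1 / (norm y)\<^sup>2)"
      using m1 by simp
    also have "\<dots> = 1 / norm y" by (simp add: real_sqrt_divide)
    also have "\<dots> \<le> 1 / r" using that \<open>0 < r\<close> by (intro frac_le) auto
    finally show ?thesis .
  qed
  have "(\<lambda>k. \<integral>y. \<psi> y * L k y \<partial>?\<mu>) \<longlonglongrightarrow> (\<integral>y. \<psi> y * ?L y \<partial>?\<mu>)"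
  proof (rule integral_dominated_convergence[where w="\<lambda>y. 1 / r * indicator (cball 0 R) y"])
    show "AE y in ?\<mu>. (\<lambda>k. \<psi> y * L k y) \<longlonglongrightarrow> \<psi> y * ?L y"
    proof (intro AE_I2)
      fix y show "(\<lambda>k. \<psi> y * L k y) \<longlonglongrightarrow> \<psi> y * ?L y"
        using near0[of 0] \<open>0 < r\<close> tendsto_mult_left[OF Llim[of y], of "\<psi> y"] by (cases "y = 0") simp_all
    qed
    show "AE y in ?\<mu>. norm (\<psi> y * L k y) \<le> 1 / r * indicator (cball 0 R) y" for k
    proof (intro AE_I2)
      fix y show "norm (\<psi> y * L k y) \<le> 1 / r * indicator (cball 0 R) y"
      proof (cases "norm y < r")
        case True
        then show ?thesis using near0[OF True] \<open>0 < r\<close> by simp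
      next
        case False
        then have "\<bar>\<psi> y\<bar> * \<bar>L k y\<bar> \<le> indicator (cball 0 R) y * (1 / r)"
          using bnd[of y] Lbnd[of y k] by (intro mult_mono) simp_all
        then show ?thesis by (simp add: abs_mult mult.commute)
      qed
    qed
    show "integrable ?\<mu> (\<lambda>y. 1 / r * indicator (cball 0 R) y)"
      using finite_emeasure_subspace_lborel_cball[OF H(1), of R] by simp
  qed measurable
  then have "(\<integral>y. \<psi> y * ?L y \<partial>?\<mu>) = 0"
    using LIMSEQ_unique[OF _ J0] unfolding eq by simp
  then show ?thesis by simp
qed

section \<open>Star bodies\<close>

lemma star_body_compact: "star_body S \<Longrightarrow> compact S"
  by (simp add: star_body_def)

text \<open>Off the origin, the points strictly below the radial function form an open set
  \<open>W\<close> by continuity of \<open>\<rho>\<close>. A proper positive multiple of a point of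
  \<open>S\<close> lies in \<open>W\<close>; the origin is covered by hypothesis.\<close>

lemma star_body_interior:
  fixes S :: "'a::euclidean_space set"
  assumes S: "star_body S" "0 \<in> interior S" and y: "y \<in> S" and t: "0 \<le> t" "t < 1"
  shows "t *\<^sub>R y \<in> interior S"
proof (cases "t *\<^sub>R y = 0")
  case False
  obtain \<rho> :: "'a \<Rightarrow> real" where cont: "continuous_on (sphere 0 1) \<rho>" 
    and S_eq: "S = {t *\<^sub>R \<theta> | t \<theta>. \<theta> \<in> sphere 0 1 \<and> 0 \<le> t \<and> t \<le> \<rho> \<theta>}"
    using S(1) unfolding star_body_def by blast
  let ?g = "\<lambda>z. \<rho> (z /\<^sub>R norm z) - norm z"
  define W where "W = (- {0}) \<inter> ?g -` {0<..}"
  have "continuous_on (- {0}) (\<lambda>z. \<rho> (z /\<^sub>R norm z))"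
  proof (rule continuous_on_compose2[OF cont])
    show "continuous_on (- {0}) (\<lambda>z::'a. z /\<^sub>R norm z)"
      by (intro continuous_intros) auto
    show "(\<lambda>z. z /\<^sub>R norm z) ` (- {0}) \<subseteq> sphere 0 1"
      by (rule image_subsetI) simp
  qed
  then have "continuous_on (- {0}) ?g"
    by (intro continuous_intros)
  then have "open W"
    unfolding W_def by (intro continuous_open_preimage) auto
  moreover have "W \<subseteq> S"
  proof
    fix z assume z: "z \<in> W"
    then have "z = norm z *\<^sub>R (z /\<^sub>R norm z)" "z /\<^sub>R norm z \<in> sphere 0 1" "norm z \<le> \<rho> (z /\<^sub>R norm z)"
      by (auto simp: W_def)
    then show "z \<in> S" unfolding S_eq using norm_ge_zero by blast
  qed
  moreover have "t *\<^sub>R y \<in> W"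
  proof -
    obtain s \<theta> where s: "y = s *\<^sub>R \<theta>" "norm \<theta> = 1" "0 \<le> s" "s \<le> \<rho> \<theta>"
      using y unfolding S_eq by auto
    have pos: "0 < t" "0 < s" using False s t by auto
    define c where "c = t * s"
    have "0 < c" "t *\<^sub>R y = c *\<^sub>R \<theta>"
      using pos s(1) by (simp_all add: c_def)
    then have "norm (t *\<^sub>R y) = c" "t *\<^sub>R y /\<^sub>R c = \<theta>"
      using s(2) by simp_all
    moreover have "c < s" using pos t by (simp add: c_def)
    ultimately show ?thesis
      using False s by (simp add: W_def)
  qed
  ultimately show ?thesis
    using interior_maximal by blast
next
  case True
  show ?thesis using S(2) unfolding True .
qed

lemma star_body_scale:
  assumes "star_body S" "0 \<in> interior S" "y \<in> S" "0 \<le> t" "t \<le> 1"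
  shows "t *\<^sub>R y \<in> S"
  using star_body_interior[OF assms(1-4)] assms(3,5) interior_subset by (cases "t = 1") auto

text \<open>The indicator is discontinuous only on the frontier, and a ray meets the frontier at
  most once because proper multiples of points of \<open>S\<close> are interior.\<close>

lemma AE_isCont_indicator_star_body:
  fixes S :: "'a::euclidean_space set"
  assumes S: "star_body S" "0 \<in> interior S" and E: "subspace E"
  shows "AE y in subspace_lborel E. isCont (indicator S :: 'a \<Rightarrow> real) y"
proof -
  have "frontier S \<in> null_sets (subspace_lborel E)"
  proof (rule null_sets_subspace_lborel_starlike[OF E frontier_closed])
    fix c :: real and x :: 'a
    assume cx: "c *\<^sub>R x \<in> frontier S" and "0 \<le> c" and x: "x \<in> frontier S"
    have cl: "closed S" using star_body_compact[OF S(1)] by (rule compact_imp_closed)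
    have mem: "x \<in> S" "c *\<^sub>R x \<in> S" "x \<notin> interior S" "c *\<^sub>R x \<notin> interior S"
      using cx x cl by (auto simp: frontier_def)
    have "\<not> c < 1"
      using star_body_interior[OF S mem(1) \<open>0 \<le> c\<close>] mem(4) by blast
    \<comment> \<open>The same argument with \<open>x\<close> as a proper multiple of
      \<open>c *\<^sub>R x\<close>.\<close>
    moreover have "\<not> 1 < c"
      using star_body_interior[OF S mem(2), of "1 / c"] mem(3) by auto
    ultimately show "c = 1" by simp
  qed
  then have "AE y in subspace_lborel E. y \<notin> frontier S"
    by (rule AE_not_in)
  then show ?thesis
    by (simp add: isCont_indicator)
qed

section \<open>Equal central hyperplane sections determine the body\<close>

lemma section_function_eq_integral:
  fixes S :: "'a::euclidean_space set"
  assumes "closed S" "subspace E"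
  shows "section_function S E = (\<integral>y. indicator S y \<partial>subspace_lborel E)"
proof -
  have "section_function S E = measure (subspace_lborel E) S"
    unfolding section_function_def
  proof (rule measure_eq_AE)
    show "AE x in subspace_lborel E. (x \<in> E \<inter> S) = (x \<in> S)"
      using AE_subspace_lborel[OF assms(2)] by eventually_elim auto
  qed (use assms in \<open>auto intro: borel_closed closed_subspace\<close>)
  then show ?thesis by simp
qed

lemma centrally_symmetric_uminus:
  "centrally_symmetric S \<Longrightarrow> - x \<in> S \<longleftrightarrow> x \<in> S"
  unfolding centrally_symmetric_def by (metis imageI minus_minus)

text \<open>If the inclusion fails, \<open>\<psi>\<close> is \<open>1\<close> on a ball around some
  \<open>v\<close> in \<open>H\<close> and nonnegative on a double cone around the line of
  \<open>v\<close>. Kernels concentrating on that line would then give a positive integral, although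
  all of them integrate \<open>\<psi>\<close> to \<open>0\<close>.\<close>

lemma star_body_funk_subset:
  fixes S S' :: "'a::euclidean_space set"
  assumes S: "star_body S" "0 \<in> interior S"
    and S': "star_body S'" "0 \<in> interior S'" "centrally_symmetric S'"
    and sym: "centrally_symmetric S"
    and H: "subspace H" "2 \<le> dim H"
    and sec: "\<And>\<xi>. \<xi> \<in> H \<Longrightarrow> \<xi> \<noteq> 0 \<Longrightarrow>
      section_function S {y \<in> H. y \<bullet> \<xi> = 0} = section_function S' {y \<in> H. y \<bullet> \<xi> = 0}"
  shows "S \<inter> H \<subseteq> S'"
proof (rule ccontr)
  assume "\<not> S \<inter> H \<subseteq> S'"
  then obtain w where w: "w \<in> S" "w \<in> H" "w \<notin> S'" by blast
  have cl: "closed S" "closed S'"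
    using S S' by (auto intro: compact_imp_closed star_body_compact)
  have [measurable]: "S \<in> sets borel" "S' \<in> sets borel"
    using cl by auto
  let ?\<mu> = "subspace_lborel H"
  define \<psi> :: "'a \<Rightarrow> real" where "\<psi> y = indicator S y - indicator S' y" for y
  have [measurable]: "\<psi> \<in> borel_measurable borel"
    unfolding \<psi>_def by measurable
  obtain R where R: "0 < R" "S \<union> S' \<subseteq> cball 0 R"
  proof -
    have "bounded (S \<union> S')"
      using S S' by (simp add: compact_imp_bounded star_body_compact)
    then show thesis
      using that by (metis bounded_subset_ballD ball_subset_cball order_trans)
  qed
  obtain r where r: "0 < r" "ball 0 r \<subseteq> S \<inter> S'"
  proof -
    have "0 \<in> interior (S \<inter> S')" using S S' by (simp add: interior_Int)
    then show thesis using that by (metis mem_interior)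
  qed
  have bnd: "\<bar>\<psi> y\<bar> \<le> indicator (cball 0 R) y" for y
    using R(2) by (auto simp: \<psi>_def indicator_def)
  have near0: "\<psi> y = 0" if "norm y < r" for y
    using r(2) that by (auto simp: \<psi>_def indicator_def)
  have ker: "(\<integral>y. \<psi> y / norm y * exp (- (((norm x)\<^sup>2 - (x \<bullet> y)\<^sup>2 / (norm y)\<^sup>2) / 2)) \<partial>?\<mu>) = 0"
    if "x \<in> H" for x
  proof (rule funk_kernel_integral_eq_0[OF H r(1) that _ bnd near0])
    fix \<xi> assume \<xi>: "\<xi> \<in> H" "\<xi> \<noteq> 0"
    let ?E = "{y \<in> H. y \<bullet> \<xi> = 0}"
    have E: "subspace ?E" using H(1) by (rule subspace_hyperplane_section)
    show "AE y in subspace_lborel ?E. isCont \<psi> y"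
      using AE_isCont_indicator_star_body[OF S E] AE_isCont_indicator_star_body[OF S'(1,2) E]
      by eventually_elim (simp add: \<psi>_def[abs_def])
    have int: "integrable (subspace_lborel ?E) (indicator A :: 'a \<Rightarrow> real)"
      if "A \<in> sets borel" "A \<subseteq> cball 0 R" for A
      using that by (intro integrable_subspace_lborel[OF E, where K=1 and R=R]) (auto simp: indicator_def)
    show "(\<integral>y. \<psi> y \<partial>subspace_lborel ?E) = 0"
      using sec[OF \<xi>] R(2) int[of S] int[of S'] unfolding section_function_eq_integral[OF cl(1) E]
        section_function_eq_integral[OF cl(2) E] \<psi>_def
      by (subst Bochner_Integration.integral_diff) auto
  qed measurable
  \<comment> \<open>Shrinking \<open>w\<close> slightly moves it into the interior of
    \<open>S\<close> while it stays outside the closed set \<open>S'\<close>.\<close>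
  obtain t where t: "0 < t" "t < 1" "t *\<^sub>R w \<notin> S'"
  proof -
    have "(\<lambda>n. (1 - inverse (real (Suc n))) *\<^sub>R w) \<longlonglongrightarrow> (1 - 0) *\<^sub>R w"
      by (intro tendsto_intros LIMSEQ_inverse_real_of_nat)
    moreover have "open (- S')" "(1 - 0) *\<^sub>R w \<in> - S'" using cl w by auto
    ultimately have "\<forall>\<^sub>F n in sequentially. (1 - inverse (real (Suc n))) *\<^sub>R w \<in> - S'"
      by (rule topological_tendstoD)
    then obtain N where N: "\<And>n. n \<ge> N \<Longrightarrow> (1 - inverse (real (Suc n))) *\<^sub>R w \<notin> S'"
      unfolding eventually_sequentially by auto
    show thesis
      \<comment> \<open>The index is \<open>Suc N\<close> rather than \<open>N\<close> because at
        index \<open>0\<close> the factor is \<open>0\<close>, violating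
        \<open>0 < t\<close>.\<close>
      by (rule that[of "1 - inverse (real (Suc (Suc N)))"]) (use N[of "Suc N"] in \<open>auto simp: field_simps\<close>)
  qed
  define v where "v = t *\<^sub>R w"
  have vH: "v \<in> H" using w H(1) by (simp add: v_def subspace_scale)
  have "v \<in> interior S \<inter> - S'"
    using t w star_body_interior[OF S w(1), of t] by (simp add: v_def)
  moreover have "open (interior S \<inter> - S')" using cl by auto
  ultimately obtain d where d: "0 < d" "ball v d \<subseteq> interior S \<inter> - S'"
    by (meson open_contains_ball)
  have v0: "v \<noteq> 0"
    using \<open>v \<in> interior S \<inter> - S'\<close> S'(2) interior_subset by blast
  then have nv: "0 < (norm v)\<^sup>2" by simp
  \<comment> \<open>As \<open>z\<close> is not in \<open>S'\<close>, a multiple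
    \<open>c *\<^sub>R z\<close> in \<open>S'\<close> must have \<open>\<bar>c\<bar> < 1\<close>;
    then it lies in \<open>S\<close> because \<open>z\<close> does. Symmetry handles negative
    \<open>c\<close>.\<close>
  have cone: "c *\<^sub>R z \<in> S" if "z \<in> ball v d" "c *\<^sub>R z \<in> S'" for c z
  proof -
    have z: "z \<in> S" "z \<notin> S'" using that(1) d(2) interior_subset by blast+
    have "\<bar>c\<bar> *\<^sub>R z \<in> S'"
      using that(2) centrally_symmetric_uminus[OF S'(3), of "c *\<^sub>R z"] by (cases "0 \<le> c") auto
    have "\<bar>c\<bar> < 1"
    proof (rule ccontr)
      assume "\<not> \<bar>c\<bar> < 1"
      then have "c \<noteq> 0" "1 / \<bar>c\<bar> \<le> 1" by auto
      then show False
        using z star_body_scale[OF S'(1,2) \<open>\<bar>c\<bar> *\<^sub>R z \<in> S'\<close>, of "1 / \<bar>c\<bar>"] by simp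
    qed
    then have "\<bar>c\<bar> *\<^sub>R z \<in> S"
      using star_body_scale[OF S z(1), of "\<bar>c\<bar>"] by simp
    then show ?thesis
      using centrally_symmetric_uminus[OF sym, of "c *\<^sub>R z"] by (cases "0 \<le> c") auto
  qed
  \<comment> \<open>For \<open>y \<noteq> 0\<close>, the squared sine of the angle between
    \<open>v\<close> and \<open>y\<close>.\<close>
  define q where "q y = 1 - (v \<bullet> y)\<^sup>2 / ((norm v)\<^sup>2 * (norm y)\<^sup>2)" for y
  have [measurable]: "q \<in> borel_measurable borel" unfolding q_def by measurable
  \<comment> \<open>Squared sine of the angle with tangent \<open>d / norm v\<close>: below this
    value the line through \<open>y\<close> meets \<open>ball v d\<close>.\<close>
  define \<eta> where "\<eta> = d\<^sup>2 / ((norm v)\<^sup>2 + d\<^sup>2)"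
  have \<eta>: "0 < \<eta>" using d nv by (simp add: \<eta>_def add_pos_pos)
  have q0: "0 \<le> q y" for y
  proof -
    have "(v \<bullet> y)\<^sup>2 \<le> (norm v)\<^sup>2 * (norm y)\<^sup>2"
      using Cauchy_Schwarz_ineq[of v y] by (simp add: power2_norm_eq_inner)
    then show ?thesis
      by (simp add: q_def divide_le_eq_1 zero_less_mult_iff) blast
  qed
  have pos: "0 \<le> \<psi> y" if "q y < \<eta>" for y
  proof -
    define p where "p = v \<bullet> y"
    have "1 - \<eta> = (norm v)\<^sup>2 / ((norm v)\<^sup>2 + d\<^sup>2)"
      using nv d by (simp add: \<eta>_def field_simps add_pos_pos)
    then have lt: "(norm v)\<^sup>2 / ((norm v)\<^sup>2 + d\<^sup>2) < p\<^sup>2 / ((norm v)\<^sup>2 * (norm y)\<^sup>2)"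
      using that by (simp add: q_def p_def)
    moreover have "0 \<le> (norm v)\<^sup>2 / ((norm v)\<^sup>2 + d\<^sup>2)" by simp
    ultimately have "p\<^sup>2 / ((norm v)\<^sup>2 * (norm y)\<^sup>2) \<noteq> 0" by linarith
    then have p0: "p \<noteq> 0" and y0: "y \<noteq> 0" by auto
    \<comment> \<open>The point of the line through \<open>y\<close> with
      \<open>v \<bullet> z = (norm v)\<^sup>2\<close>; its distance from \<open>v\<close> is
      \<open>norm v\<close> times the tangent of the angle.\<close>
    define z where "z = ((norm v)\<^sup>2 / p) *\<^sub>R y"
    have "(norm v)\<^sup>2 * ((norm v)\<^sup>2 * (norm y)\<^sup>2) < p\<^sup>2 * ((norm v)\<^sup>2 + d\<^sup>2)"
      using lt nv y0 d by (simp add: divide_simps add_pos_pos mult_ac)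
    then have "(norm v)\<^sup>2 * (norm v)\<^sup>2 * (norm y)\<^sup>2 / p\<^sup>2 - (norm v)\<^sup>2 < d\<^sup>2"
      using p0 by (simp add: field_simps)
    moreover have "(norm (v - z))\<^sup>2 = (norm v)\<^sup>2 * (norm v)\<^sup>2 * (norm y)\<^sup>2 / p\<^sup>2 - (norm v)\<^sup>2"
    proof -
      have "(norm (v - z))\<^sup>2 = (norm v)\<^sup>2 - 2 * (v \<bullet> z) + (norm z)\<^sup>2"
        by (simp add: power2_norm_eq_inner inner_diff_left inner_diff_right inner_commute)
      also have "v \<bullet> z = (norm v)\<^sup>2" using p0 by (simp add: z_def p_def)
      also have "(norm z)\<^sup>2 = (norm v)\<^sup>2 * (norm v)\<^sup>2 * (norm y)\<^sup>2 / p\<^sup>2"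
        by (simp add: z_def power_mult_distrib power_divide power2_eq_square)
      finally show ?thesis by simp
    qed
    ultimately have "(norm (v - z))\<^sup>2 < d\<^sup>2" by simp
    then have "z \<in> ball v d"
      using d by (simp add: dist_norm power_less_imp_less_base)
    moreover have "y = (p / (norm v)\<^sup>2) *\<^sub>R z"
      using p0 v0 by (simp add: z_def)
    ultimately have "y \<in> S' \<Longrightarrow> y \<in> S"
      using cone by metis
    then show ?thesis by (auto simp: \<psi>_def indicator_def)
  qed
  have "isCont q v"
    unfolding q_def using v0 by (intro continuous_intros) auto
  moreover have qv: "q v = 0"
    using v0 by (simp add: q_def power2_norm_eq_inner[symmetric] power2_eq_square)
  \<comment> \<open>The threshold \<open>\<eta> / 2\<close> leaves a gap to \<open>\<eta>\<close>:
    the kernels rescaled at \<open>\<eta> / 2\<close> stay bounded below near \<open>v\<close> but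
    decay exponentially where \<open>q y \<ge> \<eta>\<close>.\<close>
  ultimately obtain d' where d': "0 < d'" "\<And>y. dist y v < d' \<Longrightarrow> q y < \<eta> / 2"
    using \<eta> unfolding continuous_at_eps_delta dist_real_def
    by (metis abs_less_iff diff_zero half_gt_zero)
  define \<delta> where "\<delta> = min d d'"
  have \<delta>: "0 < \<delta>" using d d' by (simp add: \<delta>_def)
  have near: "\<psi> y = 1 \<and> q y < \<eta> / 2 \<and> y \<in> cball 0 R \<and> y \<noteq> 0" if "y \<in> ball v \<delta>" for y
  proof -
    have "y \<in> ball v d" "dist y v < d'" using that by (auto simp: \<delta>_def dist_commute)
    then have "y \<in> S" "y \<notin> S'" "q y < \<eta> / 2"
      using d(2) d'(2) interior_subset by blast+
    moreover have "0 \<in> S'" using S'(2) interior_subset by blast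
    ultimately show ?thesis using R(2) by (auto simp: \<psi>_def)
  qed
  define m where "m = measure ?\<mu> (ball v \<delta>)"
  define M where "M = measure ?\<mu> (cball 0 R)"
  have fin: "emeasure ?\<mu> (cball 0 R) < \<infinity>"
    using H(1) by (rule finite_emeasure_subspace_lborel_cball)
  have "ball v \<delta> \<subseteq> cball 0 R" using near by blast
  then have finb: "emeasure ?\<mu> (ball v \<delta>) < \<infinity>"
    using fin emeasure_mono[of "ball v \<delta>" "cball 0 R" ?\<mu>] by (auto intro: le_less_trans)
  have "0 < m"
    using emeasure_subspace_lborel_ball_pos[OF H(1) vH \<delta>] finb
    by (simp add: m_def measure_def enn2real_positive_iff)
  have key: "m / R \<le> M / r * exp (- (l\<^sup>2 * (\<eta> / 4)))" for l :: real
  proof -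
    let ?f = "\<lambda>y. \<psi> y / norm y * exp (l\<^sup>2 * (\<eta> / 2 - q y) / 2)"
    \<comment> \<open>A minorant of \<open>?f\<close>: near \<open>v\<close> the exponent is
      nonnegative and \<open>norm y \<le> R\<close>; elsewhere in the cone \<open>?f\<close> is
      nonnegative; outside it \<open>\<bar>?f\<bar>\<close> is at most the subtracted term.\<close>
    let ?h = "\<lambda>y. 1 / R * indicator (ball v \<delta>) y - 1 / r * exp (- (l\<^sup>2 * (\<eta> / 4))) * indicator (cball 0 R) y"
    have f0: "(\<integral>y. ?f y \<partial>?\<mu>) = 0"
    proof -
      \<comment> \<open>For this multiple of \<open>v\<close> the kernel exponent is
        \<open>- (l\<^sup>2 * q y / 2)\<close>; the constant factor
        \<open>exp (l\<^sup>2 * (\<eta> / 2) / 2)\<close> only rescales a vanishing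
        integral.\<close>
      let ?x = "(l / norm v) *\<^sub>R v"
      have "?f y = exp (l\<^sup>2 * (\<eta> / 2) / 2) *
          (\<psi> y / norm y * exp (- (((norm ?x)\<^sup>2 - (?x \<bullet> y)\<^sup>2 / (norm y)\<^sup>2) / 2)))" for y
      proof (cases "y = 0")
        case False
        have "(norm ?x)\<^sup>2 - (?x \<bullet> y)\<^sup>2 / (norm y)\<^sup>2 = l\<^sup>2 * q y"
          using v0 False by (simp add: q_def power_mult_distrib power_divide right_diff_distrib)
        moreover have "l\<^sup>2 * (\<eta> / 2 - q y) / 2 = l\<^sup>2 * (\<eta> / 2) / 2 + - (l\<^sup>2 * q y / 2)"
          by (simp add: field_simps)
        ultimately show ?thesis by (simp only: exp_add mult_ac)
      qed simp
      then have "(\<integral>y. ?f y \<partial>?\<mu>) = (\<integral>y. exp (l\<^sup>2 * (\<eta> / 2) / 2) *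
          (\<psi> y / norm y * exp (- (((norm ?x)\<^sup>2 - (?x \<bullet> y)\<^sup>2 / (norm y)\<^sup>2) / 2))) \<partial>?\<mu>)"
        by (simp only:)
      also have "\<dots> = 0"
        unfolding integral_mult_right_zero ker[OF subspace_scale[OF H(1) vH]] by simp
      finally show ?thesis .
    qed
    have le: "?h y \<le> ?f y" for y
    proof (cases "q y < \<eta>")
      case True
      have f_nonneg: "0 \<le> ?f y" using pos[OF True] by simp
      show ?thesis
      proof (cases "y \<in> ball v \<delta>")
        case True
        note n = near[OF True]
        have "1 / R * 1 \<le> 1 / norm y * exp (l\<^sup>2 * (\<eta> / 2 - q y) / 2)"
          using n by (intro mult_mono frac_le) auto
        moreover have "0 \<le> 1 / r * exp (- (l\<^sup>2 * (\<eta> / 4)))" using r by simp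
        ultimately show ?thesis using True n by (simp add: indicator_def)
      next
        case False
        have "0 \<le> 1 / r * exp (- (l\<^sup>2 * (\<eta> / 4))) * indicator (cball 0 R) y" using r by simp
        then show ?thesis using False f_nonneg by simp
      qed
    next
      case False
      then have nb: "y \<notin> ball v \<delta>" using near[of y] \<eta> by auto
      have "\<bar>?f y\<bar> \<le> 1 / r * exp (- (l\<^sup>2 * (\<eta> / 4))) * indicator (cball 0 R) y"
      proof (cases "norm y < r")
        case True
        then show ?thesis using near0[OF True] r by simp
      next
        case ny: False
        have "l\<^sup>2 * (\<eta> / 2 - q y) / 2 \<le> l\<^sup>2 * (- \<eta> / 2) / 2"
          using False by (intro divide_right_mono mult_left_mono) auto
        then have "exp (l\<^sup>2 * (\<eta> / 2 - q y) / 2) \<le> exp (- (l\<^sup>2 * (\<eta> / 4)))" by simp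
        moreover have "1 / norm y \<le> 1 / r" using ny r by (intro frac_le) auto
        ultimately have "\<bar>\<psi> y\<bar> * ((1 / norm y) * exp (l\<^sup>2 * (\<eta> / 2 - q y) / 2))
            \<le> indicator (cball 0 R) y * ((1 / r) * exp (- (l\<^sup>2 * (\<eta> / 4))))"
          using bnd[of y] r by (intro mult_mono) auto
        then show ?thesis by (simp add: abs_mult mult_ac)
      qed
      then have "- (1 / r * exp (- (l\<^sup>2 * (\<eta> / 4))) * indicator (cball 0 R) y) \<le> ?f y"
        using abs_le_D2 by (subst minus_le_iff)
      moreover have "?h y = - (1 / r * exp (- (l\<^sup>2 * (\<eta> / 4))) * indicator (cball 0 R) y)"
        using nb by simp
      ultimately show ?thesis by (simp only:)
    qed
    have "(\<integral>y. ?h y \<partial>?\<mu>) \<le> (\<integral>y. ?f y \<partial>?\<mu>)"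
    proof (rule integral_mono)
      show "integrable ?\<mu> ?f"
      proof (rule integrable_subspace_lborel[OF H(1), where R=R and K="1 / r * exp (l\<^sup>2 * (\<eta> / 2) / 2)"])
        fix y
        show "\<bar>?f y\<bar> \<le> 1 / r * exp (l\<^sup>2 * (\<eta> / 2) / 2) * indicator (cball 0 R) y"
        proof (cases "norm y < r")
          case True
          then show ?thesis using near0[OF True] r by simp
        next
          case False
          have "l\<^sup>2 * (\<eta> / 2 - q y) / 2 \<le> l\<^sup>2 * (\<eta> / 2) / 2"
            using q0[of y] by (intro divide_right_mono mult_left_mono) auto
          then have "exp (l\<^sup>2 * (\<eta> / 2 - q y) / 2) \<le> exp (l\<^sup>2 * (\<eta> / 2) / 2)" by simp
          moreover have "1 / norm y \<le> 1 / r" using False r by (intro frac_le) auto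
          ultimately have "\<bar>\<psi> y\<bar> * ((1 / norm y) * exp (l\<^sup>2 * (\<eta> / 2 - q y) / 2))
              \<le> indicator (cball 0 R) y * ((1 / r) * exp (l\<^sup>2 * (\<eta> / 2) / 2))"
            using bnd[of y] r by (intro mult_mono) auto
          then show ?thesis by (simp add: abs_mult mult_ac)
        qed
      qed measurable
      show "integrable ?\<mu> ?h"
        using fin finb by (intro Bochner_Integration.integrable_diff integrable_mult_right integrable_real_indicator) auto
    qed (rule le)
    moreover have "(\<integral>y. ?h y \<partial>?\<mu>) = 1 / R * m - 1 / r * exp (- (l\<^sup>2 * (\<eta> / 4))) * M"
      using fin finb by (simp add: m_def M_def)
    ultimately show ?thesis using f0 by (simp add: mult.commute)
  qed
  \<comment> \<open>As \<open>l\<close> grows, the upper bound in \<open>key\<close> tends to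
    \<open>0\<close> while the positive lower bound stays fixed.\<close>
  have "((\<lambda>l. M / r * exp (- (l\<^sup>2 * (\<eta> / 4)))) \<longlongrightarrow> M / r * 0) at_top"
    using \<eta> by (intro tendsto_mult_left) real_asymp
  then have "m / R \<le> M / r * 0"
    using key by (intro tendsto_lowerbound[OF _ always_eventually]) auto
  then show False using \<open>0 < m\<close> R by (simp add: divide_le_0_iff)
qed

section \<open>Reduction to hyperplanes of subspaces of dimension k + 1\<close>

lemma star_body_eq_if_sections_eq:
  fixes S S' :: "'a::euclidean_space set"
  assumes k: "2 \<le> k" "k + 2 \<le> DIM('a)" and F: "F \<in> grassmannian (DIM('a) - k)"
    and S: "star_body S" "0 \<in> interior S" "centrally_symmetric S"
    and S': "star_body S'" "0 \<in> interior S'" "centrally_symmetric S'"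
    and sec: "\<And>E. E \<in> Xi k F \<Longrightarrow> section_function S E = section_function S' E"
  shows "S = S'"
proof -
  have F': "subspace F" "dim F = DIM('a) - k"
    using F by (auto simp: grassmannian_def)
  obtain T where T: "subspace T" "T \<subseteq> F" "dim T = 2"
  proof -
    have "2 \<le> dim F" using F' k by linarith
    from choose_subspace_of_subspace[OF this] show thesis
      using that unfolding span_eq_iff[THEN iffD2, OF F'(1)] by blast
  qed
  have "x \<in> S \<longleftrightarrow> x \<in> S'" for x
  proof -
    obtain B where B: "B \<subseteq> insert x T" "independent B" "insert x T \<subseteq> span B" "card B = dim (insert x T)"
      by (rule basis_exists)
    \<comment> \<open>The plane and \<open>x\<close> span at most 3 dimensions, and
      \<open>3 \<le> Suc k\<close> because \<open>2 \<le> k\<close>.\<close>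
    have "dim (insert x T) \<le> 3" using T(3) by (simp add: dim_insert)
    then have cardB: "card B \<le> Suc k" using B(4) k by simp
    obtain B' where B': "B \<subseteq> B'" "independent B'" "UNIV \<subseteq> span B'"
      by (rule maximal_independent_subset_extend[OF subset_UNIV B(2)])
    have finB': "finite B'" using independent_imp_finite[OF B'(2)] .
    have "card B' = DIM('a)"
      using dim_span_eq_card_independent[OF B'(2)] unfolding top.extremum_uniqueI[OF B'(3)] dim_UNIV ..
    \<comment> \<open>\<open>C\<close> lies between a basis of the span of \<open>x\<close> and
      \<open>T\<close> and a basis of the whole space, so its span has the required dimension and
      contains both.\<close>
    then obtain C where C: "B \<subseteq> C" "C \<subseteq> B'" "card C = Suc k"
      using exists_subset_between[OF cardB _ B'(1) finB'] k by auto
    define H where "H = span C"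
    have H: "subspace H" "dim H = Suc k"
      using independent_mono[OF B'(2) C(2)] C(3) by (auto simp: H_def dim_eq_card_independent)
    have "insert x T \<subseteq> H"
      using B(3) span_mono[OF C(1)] by (auto simp: H_def)
    then have xH: "x \<in> H" and TH: "T \<subseteq> H" by auto
    have secH: "section_function S {y \<in> H. y \<bullet> \<xi> = 0} = section_function S' {y \<in> H. y \<bullet> \<xi> = 0}"
      if \<xi>: "\<xi> \<in> H" "\<xi> \<noteq> 0" for \<xi>
    proof (rule sec)
      let ?E = "{y \<in> H. y \<bullet> \<xi> = 0}"
      have E: "subspace ?E" using H(1) by (rule subspace_hyperplane_section)
      obtain D where D: "orthonormal_basis ?E D" using orthonormal_basis_exists[OF E] by blast
      have dimE: "dim ?E = k"
        using onb_card[OF D] onb_card[OF onb_insert_normal(1)[OF H(1) \<xi> D]]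
          onb_insert_normal(2)[OF H(1) \<xi> D] onb_finite[OF D] H(2) by simp
      \<comment> \<open>\<open>T\<close> has dimension 2 and \<open>?E\<close> dimension
        \<open>k\<close> inside a space of dimension \<open>k + 1\<close>, so their intersection has
        dimension at least 1.\<close>
      have "dim {a + b |a b. a \<in> T \<and> b \<in> ?E} \<le> dim H"
        using TH H(1) by (intro dim_subset) (auto intro: subspace_add)
      then have "dim (T \<inter> ?E) \<noteq> 0"
        using dim_sums_Int[OF T(1) E] T(3) dimE H(2) by linarith
      then have "\<not> T \<inter> ?E \<subseteq> {0}" by (simp add: dim_eq_0)
      then have "?E \<inter> F \<noteq> {0}" using T(2) by blast
      then show "?E \<in> Xi k F"
        using E dimE by (simp add: Xi_def grassmannian_def)
    qed
    have "2 \<le> dim H" using H k by simp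
    then show ?thesis
      using star_body_funk_subset[OF S(1,2) S' S(3) H(1) _ secH]
        star_body_funk_subset[OF S'(1,2) S S'(3) H(1) _ secH[symmetric]] xH by blast
  qed
  then show ?thesis by blast
qed

theorem corollary4p5:
  fixes k :: nat and F :: "(real ^ 'n) set" and U :: "(real ^ 'n) set set"
    and S S' :: "(real ^ 'n) set"
  assumes "2 \<le> k" and "k \<le> CARD('n) - 2"
    and "F \<in> grassmannian (CARD('n) - k)"
    and "openin (grassmannian_topology k) U" and "Xi k F \<subseteq> U"
    and "star_body S" and "0 \<in> interior S" and "centrally_symmetric S"
    and "star_body S'" and "0 \<in> interior S'" and "centrally_symmetric S'"
    and "\<And>E. E \<in> U \<Longrightarrow> section_function S E = section_function S' E"
  shows "S = S'"
proof (rule star_body_eq_if_sections_eq)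
  \<comment> \<open>From \<open>2 \<le> k\<close> the natural-number subtraction
    \<open>CARD('n) - 2\<close> is not truncated.\<close>
  show "k + 2 \<le> DIM(real ^ 'n)" "F \<in> grassmannian (DIM(real ^ 'n) - k)"
    using assms(1,2,3) by auto
  show "section_function S E = section_function S' E" if "E \<in> Xi k F" for E
    using assms(5,12) that by blast
qed fact+

end
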